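(* Consider the problem data $(\mathcal{G},f_i,\mathcal{X}_i,A_i,c)$, the barrier problem with parameter $\rho>0$, and the DFM iteration described in the context. Suppose that Assumption 1 and Assumption 2 (both stated in the context) hold, and let $\{\mathbf{x}^k\}_{k\ge 0}$ be generated by DFM from an initial point $\mathbf{x}^0$ that is feasible for the barrier problem (BP). Then every $\mathbf{x}^k$, $k\ge 0$, is feasible for (BP) and for the original problem (P), and $$\sum_{k=0}^\infty \|\nabla F(\mathbf{x}^k)\|_W^2\le 2(\rho L_B+L)(F(\mathbf{x}^0)-f^\star),$$ where $L=\max_{i\in\mathcal{V}} L_i$ and $$L_B=\left(4\beta_1^2\left(\frac{F(\mathbf{x}^0)-f^\star}{\rho}\right)^3+2\beta\left(\frac{F(\mathbf{x}^0)-f^\star}{\rho}\right)^2\right)\max_{i\in\mathcal{V}}q_i .$$ In addition, let $F^\star$ be the optimal value of (BP) and $\lambda_W$ the smallest nonzero eigenvalue of $W$. (1) If each $f_i$ is convex and the set $\mathcal{C}:=\{\mathbf{x}: \mathbf{x}\text{ is feasible for (BP) and }F(\mathbf{x})\le F(\mathbf{x}^0)\}$ is compact, with diameter $R$, then for all $k\ge 1$ $$F(\mathbf{x}^k)-F^\star\le \frac{2(L+\rho L_B)R^2}{k\lambda_W}.$$ (2) If each $f_i$ is $\sigma$-strongly convex for some $\sigma>0$, then for all $k\ge 0$ $$F(\mathbf{x}^k)-F^\star\le\left(1-\frac{\sigma\lambda_W}{L+\rho L_B}\right)^k(F(\mathbf{x}^0)-F^\star).$$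
   Context: **Problem.** $\mathcal{G}=(\mathcal{V},\mathcal{E})$ is an undirected graph with $\mathcal{V}=\{1,\dots,n\}$; $\mathcal{N}_i=\{j:\{i,j\}\in\mathcal{E}\}$ and $\bar{\mathcal{N}}_i=\mathcal{N}_i\cup\{i\}$. For each $i\in\mathcal{V}$ there are a function $f_i:\mathbb{R}^{d_i}\to\mathbb{R}$, a set $\mathcal{X}_i\subset\mathbb{R}^{d_i}$ and a matrix $A_i\in\mathbb{R}^{m\times d_i}$; $c\in\mathbb{R}^m$. Write $N=\sum_i d_i$, $\mathbf{x}=[x_1^T,\dots,x_n^T]^T\in\mathbb{R}^N$, $A=[A_1,\dots,A_n]$, $f(\mathbf{x})=\sum_i f_i(x_i)$. The original problem is (P) minimize $\sum_{i\in\mathcal{V}}f_i(x_i)$ subject to $x_i\in\mathcal{X}_i$ for all $i$ and $\sum_{i\in\mathcal{V}}A_ix_i=c$, with optimal value $f^\star$. **Assumption 1.** (a) Each $f_i$ is $L_i$-smooth for some $L_i>0$, i.e. differentiable with $L_i$-Lipschitz gradient on $\mathbb{R}^{d_i}$. (b) $\mathcal{X}_i=\{x\in\mathbb{R}^{d_i}:g_i^j(x)\le 0,\ j=1,\dots,q_i\}$ for convex, $\beta$-smooth functions $g_i^j:\mathbb{R}^{d_i}\to\mathbb{R}$ (differentiable, with $\beta$-Lipschitz gradient on $\mathbb{R}^{d_i}$), and each $g_i^j$ is $\beta_1$-Lipschitz continuous on $\mathcal{X}_i$. (c) There exist $\{\tilde{x}_i\}_{i\in\mathcal{V}}$ with $\sum_iA_i\tilde{x}_i=c$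 and $g_i^j(\tilde{x}_i)<0$ for all $i$ and $j=1,\dots,q_i$. (d) $f^\star>-\infty$. **Assumption 2 (reachability).** For $i\in\mathcal{V}$ let $\mathcal{S}_i=\{\mathbf{u}=[u_1^T,\dots,u_n^T]^T\in\mathbb{R}^N: u_j\in\mathbb{R}^{d_j},\ u_j=\mathbf{0}\ \forall j\notin\bar{\mathcal{N}}_i,\ \sum_{j\in\bar{\mathcal{N}}_i}A_ju_j=\mathbf{0}\}$. Then $\mathcal{S}_1+\dots+\mathcal{S}_n=\operatorname{Null}(A)$ (Minkowski sum). **Barrier problem.** Fix $\rho>0$. Let $\tilde{\mathcal{X}}_i=\{x_i\in\mathbb{R}^{d_i}:g_i^j(x_i)<0,\ j=1,\dots,q_i\}$, $\tilde{\mathcal{X}}=\tilde{\mathcal{X}}_1\times\dots\times\tilde{\mathcal{X}}_n$, $B_i(x_i)=-\sum_{j=1}^{q_i}1/g_i^j(x_i)$ for $x_i\in\tilde{\mathcal{X}}_i$, $B(\mathbf{x})=\sum_iB_i(x_i)$, $F(\mathbf{x})=f(\mathbf{x})+\rho B(\mathbf{x})$. (BP) minimize $F(\mathbf{x})$ subject to $\mathbf{x}\in\tilde{\mathcal{X}}$, $A\mathbf{x}=c$. **DFM algorithm.** Start from $\mathbf{x}^0$ feasible for (BP). Let $\eta_j=1/\max_{\ell\in\bar{\mathcal{N}}_j}|\bar{\mathcal{N}}_\ell|$. At iteration $k\ge 0$ let $f_i^k(x_i)=f_i(x_i^k)+\langle\nabla f_i(x_i^k),x_i-x_i^k\rangle+\frac{L_i}{2}\|x_i-x_i^k\|^2$.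 Each node $i$ computes $\{p_{ij}^k\}_{j\in\bar{\mathcal{N}}_i}$, the optimal solution of: minimize over $p_{ij}\in\mathbb{R}^{d_j}$, $j\in\bar{\mathcal{N}}_i$, the function $\sum_{j\in\bar{\mathcal{N}}_i}\big(f_j^k(x_j^k+p_{ij})+\rho B_j(x_j^k+p_{ij})\big)$ subject to $\sum_{j\in\bar{\mathcal{N}}_i}A_jp_{ij}=\mathbf{0}$ and $x_j^k+p_{ij}\in\tilde{\mathcal{X}}_j$ for all $j\in\bar{\mathcal{N}}_i$. Then $x_i^{k+1}=x_i^k+\sum_{j\in\bar{\mathcal{N}}_i}\eta_jp_{ji}^k$, and $\mathbf{x}^k=[(x_1^k)^T,\dots,(x_n^k)^T]^T$. **Other notation.** $P_i\in\mathbb{R}^{N\times N}$ is the orthogonal projection matrix onto $\mathcal{S}_i$ and $W=\sum_{i\in\mathcal{V}}\eta_iP_i$ (positive semidefinite); $\|x\|_W=\sqrt{x^TWx}$. A function $h:\mathbb{R}^d\to\mathbb{R}$ is $\sigma$-strongly convex if $h(y)-h(x)\ge\langle g_x,y-x\rangle+\frac{\sigma}{2}\|x-y\|^2$ for all $x,y$ and all $g_x\in\partial h(x)$. *)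

theory Defs
  imports "HOL-Analysis.Analysis"
begin

section \<open>Calculus on a subspace\<close>

text \<open>
  The notions below are relative to a linear subspace \<open>S\<close>, which stands for a space \<open>R^d\<close> in its
  own right. The gradient is the representing vector inside \<open>S\<close> of the derivative along \<open>S\<close>; for
  \<open>S = UNIV\<close> it is the gradient of the library predicate \<^const>\<open>gderiv\<close>.
\<close>

definition grad_on :: "'a::euclidean_space set \<Rightarrow> ('a \<Rightarrow> real) \<Rightarrow> 'a \<Rightarrow> 'a" where
  "grad_on S h x = (THE v. v \<in> S \<and> (h has_derivative (\<lambda>u. u \<bullet> v)) (at x within S))"

abbreviation grad :: "('a::euclidean_space \<Rightarrow> real) \<Rightarrow> 'a \<Rightarrow> 'a" where
  "grad \<equiv> grad_on UNIV"

definition smooth_fun_on :: "'a::euclidean_space set \<Rightarrow> real \<Rightarrow> ('a \<Rightarrow> real) \<Rightarrow> bool" where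
  "smooth_fun_on S l h \<longleftrightarrow>
     (\<forall>x\<in>S. h differentiable (at x within S)) \<and> l-lipschitz_on S (grad_on S h)"

definition subdiff_on :: "'a::euclidean_space set \<Rightarrow> ('a \<Rightarrow> real) \<Rightarrow> 'a \<Rightarrow> 'a set" where
  "subdiff_on S h x = {v \<in> S. \<forall>y\<in>S. h y \<ge> h x + v \<bullet> (y - x)}"

text \<open>
  Convexity is part of strong convexity: otherwise the inequality would be vacuous at every point
  where the subdifferential is empty.
\<close>

definition strongly_convex_on :: "'a::euclidean_space set \<Rightarrow> real \<Rightarrow> ('a \<Rightarrow> real) \<Rightarrow> bool" where
  "strongly_convex_on S \<sigma> h \<longleftrightarrow> convex_on S h \<and>
     (\<forall>x\<in>S. \<forall>y\<in>S. \<forall>v\<in>subdiff_on S h x.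
        h y - h x \<ge> v \<bullet> (y - x) + \<sigma> / 2 * (norm (x - y))\<^sup>2)"

definition opt_value :: "'a set \<Rightarrow> ('a \<Rightarrow> real) \<Rightarrow> ereal" where
  "opt_value S h = (INF x\<in>S. ereal (h x))"


section \<open>Matrices\<close>

definition orth_proj_matrix :: "(real^'n::finite) set \<Rightarrow> real^'n^'n" where
  "orth_proj_matrix S = (THE P. \<forall>x. P *v x \<in> S \<and> (\<forall>s\<in>S. orthogonal (x - P *v x) s))"

definition eigenvalues :: "real^'n::finite^'n \<Rightarrow> real set" where
  "eigenvalues M = {\<mu>. \<exists>v. v \<noteq> 0 \<and> M *v v = \<mu> *\<^sub>R v}"

definition wnorm :: "real^'n::finite^'n \<Rightarrow> real^'n \<Rightarrow> real" where
  "wnorm M x = sqrt (x \<bullet> (M *v x))"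


section \<open>Problem data\<close>

text \<open>
  The nodes are the elements of the finite type \<open>'v\<close>. The stacked space \<open>R^N\<close> is \<open>real^'N\<close>; every
  coordinate has an owning node, and \<open>d\<^sub>i\<close> is the number of coordinates owned by node \<open>i\<close>. The space
  of the \<open>i\<close>-th block (written \<open>blk D i\<close> below) consists of the vectors that vanish at all
  coordinates not owned by \<open>i\<close>, so the block dimensions are arbitrary and independent of each other.
  The functions \<open>obj D i\<close> and \<open>ineq D i j\<close> matter only on \<open>blk D i\<close>. The columns of \<open>coef D\<close> owned by
  \<open>i\<close> form the matrix \<open>A\<^sub>i\<close>; thus \<open>A\<^sub>i u\<close> is \<open>coef D *v u\<close> for \<open>u \<in> blk D i\<close>.
\<close>

record ('N, 'm, 'v) problem =
  owner :: "'N::finite \<Rightarrow> 'v::finite"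
  edges :: "'v set set"
  obj :: "'v \<Rightarrow> real^'N \<Rightarrow> real"
  nineq :: "'v \<Rightarrow> nat"
  ineq :: "'v \<Rightarrow> nat \<Rightarrow> real^'N \<Rightarrow> real"
  coef :: "real^'N^'m::finite"
  rhs :: "real^'m"

definition undirected_graph :: "'v set set \<Rightarrow> bool" where
  "undirected_graph E \<longleftrightarrow> (\<forall>e\<in>E. \<exists>i j. e = {i, j})"

definition nbrs :: "('N::finite, 'm::finite, 'v::finite) problem \<Rightarrow> 'v \<Rightarrow> 'v set" where
  "nbrs D i = {j. {i, j} \<in> edges D}"

definition cnbrs :: "('N::finite, 'm::finite, 'v::finite) problem \<Rightarrow> 'v \<Rightarrow> 'v set" where
  "cnbrs D i = nbrs D i \<union> {i}"

definition blk :: "('N::finite, 'm::finite, 'v::finite) problem \<Rightarrow> 'v \<Rightarrow> (real^'N) set" where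
  "blk D i = {x. \<forall>s. owner D s \<noteq> i \<longrightarrow> x $ s = 0}"

definition part :: "('N::finite, 'm::finite, 'v::finite) problem \<Rightarrow> 'v \<Rightarrow> real^'N \<Rightarrow> real^'N" where
  "part D i x = (\<chi> s. if owner D s = i then x $ s else 0)"

definition Xset :: "('N::finite, 'm::finite, 'v::finite) problem \<Rightarrow> 'v \<Rightarrow> (real^'N) set" where
  "Xset D i = {u \<in> blk D i. \<forall>j\<in>{1..nineq D i}. ineq D i j u \<le> 0}"

definition Xint :: "('N::finite, 'm::finite, 'v::finite) problem \<Rightarrow> 'v \<Rightarrow> (real^'N) set" where
  "Xint D i = {u \<in> blk D i. \<forall>j\<in>{1..nineq D i}. ineq D i j u < 0}"

definition total_obj :: "('N::finite, 'm::finite, 'v::finite) problem \<Rightarrow> real^'N \<Rightarrow> real" where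
  "total_obj D x = (\<Sum>i\<in>UNIV. obj D i (part D i x))"

definition feas_P :: "('N::finite, 'm::finite, 'v::finite) problem \<Rightarrow> (real^'N) set" where
  "feas_P D = {x. (\<forall>i. part D i x \<in> Xset D i) \<and> (\<Sum>i\<in>UNIV. coef D *v part D i x) = rhs D}"

definition opt_P :: "('N::finite, 'm::finite, 'v::finite) problem \<Rightarrow> ereal" where
  "opt_P D = opt_value (feas_P D) (total_obj D)"

definition regular_problem ::
    "('N::finite, 'm::finite, 'v::finite) problem \<Rightarrow> ('v \<Rightarrow> real) \<Rightarrow> real \<Rightarrow> real \<Rightarrow> bool" where
  "regular_problem D L \<beta> \<beta>\<^sub>1 \<longleftrightarrow>
     (\<forall>i. L i > 0 \<and> smooth_fun_on (blk D i) (L i) (obj D i)) \<and>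
     (\<forall>i. \<forall>j\<in>{1..nineq D i}.
        convex_on (blk D i) (ineq D i j) \<and>
        smooth_fun_on (blk D i) \<beta> (ineq D i j) \<and>
        \<beta>\<^sub>1-lipschitz_on (Xset D i) (ineq D i j)) \<and>
     (\<exists>xt. (\<forall>i. xt i \<in> blk D i) \<and> (\<Sum>i\<in>UNIV. coef D *v xt i) = rhs D \<and>
        (\<forall>i. \<forall>j\<in>{1..nineq D i}. ineq D i j (xt i) < 0)) \<and>
     opt_P D > -\<infinity>"

definition local_null :: "('N::finite, 'm::finite, 'v::finite) problem \<Rightarrow> 'v \<Rightarrow> (real^'N) set" where
  "local_null D i =
     {u. (\<forall>j. j \<notin> cnbrs D i \<longrightarrow> part D j u = 0) \<and> (\<Sum>j\<in>cnbrs D i. coef D *v part D j u) = 0}"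

text \<open>The sum on the left is the Minkowski sum of sets.\<close>

definition reachability :: "('N::finite, 'm::finite, 'v::finite) problem \<Rightarrow> bool" where
  "reachability D \<longleftrightarrow> (\<Sum>i\<in>UNIV. local_null D i) = {u. coef D *v u = 0}"


section \<open>Barrier problem\<close>

definition barrier ::
    "('N::finite, 'm::finite, 'v::finite) problem \<Rightarrow> 'v \<Rightarrow> real^'N \<Rightarrow> real" where
  "barrier D i u = - (\<Sum>j=1..nineq D i. 1 / ineq D i j u)"

definition total_barrier :: "('N::finite, 'm::finite, 'v::finite) problem \<Rightarrow> real^'N \<Rightarrow> real" where
  "total_barrier D x = (\<Sum>i\<in>UNIV. barrier D i (part D i x))"

definition barrier_obj ::
    "('N::finite, 'm::finite, 'v::finite) problem \<Rightarrow> real \<Rightarrow> real^'N \<Rightarrow> real" where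
  "barrier_obj D \<rho> x = total_obj D x + \<rho> * total_barrier D x"

definition feas_BP :: "('N::finite, 'm::finite, 'v::finite) problem \<Rightarrow> (real^'N) set" where
  "feas_BP D = {x. (\<forall>i. part D i x \<in> Xint D i) \<and> coef D *v x = rhs D}"

definition opt_BP :: "('N::finite, 'm::finite, 'v::finite) problem \<Rightarrow> real \<Rightarrow> ereal" where
  "opt_BP D \<rho> = opt_value (feas_BP D) (barrier_obj D \<rho>)"


section \<open>The DFM iteration\<close>

definition step_weight :: "('N::finite, 'm::finite, 'v::finite) problem \<Rightarrow> 'v \<Rightarrow> real" where
  "step_weight D j = 1 / real (MAX l\<in>cnbrs D j. card (cnbrs D l))"

text \<open>The quadratic model of \<open>obj D i\<close> at the point \<open>y\<close>, evaluated at \<open>u\<close>.\<close>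

definition quad_model ::
    "('N::finite, 'm::finite, 'v::finite) problem \<Rightarrow> ('v \<Rightarrow> real) \<Rightarrow> 'v \<Rightarrow> real^'N \<Rightarrow> real^'N \<Rightarrow> real" where
  "quad_model D L i y u =
     obj D i y + grad_on (blk D i) (obj D i) y \<bullet> (u - y) + L i / 2 * (norm (u - y))\<^sup>2"

definition local_feasible ::
    "('N::finite, 'm::finite, 'v::finite) problem \<Rightarrow> 'v \<Rightarrow> real^'N \<Rightarrow> ('v \<Rightarrow> real^'N) \<Rightarrow> bool" where
  "local_feasible D i x p \<longleftrightarrow>
     (\<forall>j\<in>cnbrs D i. p j \<in> blk D j \<and> part D j x + p j \<in> Xint D j) \<and>
     (\<Sum>j\<in>cnbrs D i. coef D *v p j) = 0"

definition local_obj ::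
    "('N::finite, 'm::finite, 'v::finite) problem \<Rightarrow> ('v \<Rightarrow> real) \<Rightarrow> real \<Rightarrow> 'v \<Rightarrow> real^'N \<Rightarrow>
     ('v \<Rightarrow> real^'N) \<Rightarrow> real" where
  "local_obj D L \<rho> i x p =
     (\<Sum>j\<in>cnbrs D i. quad_model D L j (part D j x) (part D j x + p j)
                      + \<rho> * barrier D j (part D j x + p j))"

text \<open>
  In \<open>p k i j\<close> the index \<open>i\<close> is the node that solves the subproblem; entries with \<open>j \<notin> cnbrs D i\<close>
  are irrelevant.
\<close>

definition dfm_sequence ::
    "('N::finite, 'm::finite, 'v::finite) problem \<Rightarrow> ('v \<Rightarrow> real) \<Rightarrow> real \<Rightarrow> (nat \<Rightarrow> real^'N) \<Rightarrow> bool" where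
  "dfm_sequence D L \<rho> x \<longleftrightarrow>
     (\<exists>p. \<forall>k i.
        is_arg_min (local_obj D L \<rho> i (x k)) (local_feasible D i (x k)) (p k i) \<and>
        part D i (x (Suc k)) = part D i (x k) + (\<Sum>j\<in>cnbrs D i. step_weight D j *\<^sub>R p k j i))"


section \<open>Quantities in the convergence bounds\<close>

definition weight_matrix :: "('N::finite, 'm::finite, 'v::finite) problem \<Rightarrow> real^'N^'N" where
  "weight_matrix D = (\<Sum>i\<in>UNIV. step_weight D i *\<^sub>R orth_proj_matrix (local_null D i))"

text \<open>
  Unspecified if the matrix is zero, which happens only if \<open>coef D\<close> has trivial kernel (under
  \<open>reachability\<close>), so that the feasible set of the barrier problem has at most one point.
\<close>

definition least_nonzero_eigenvalue :: "real^'n::finite^'n \<Rightarrow> real" where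
  "least_nonzero_eigenvalue M = Min {\<mu> \<in> eigenvalues M. \<mu> \<noteq> 0}"

definition max_smoothness :: "('v::finite \<Rightarrow> real) \<Rightarrow> real" where
  "max_smoothness L = (MAX i. L i)"

definition barrier_smoothness ::
    "('N::finite, 'm::finite, 'v::finite) problem \<Rightarrow> real \<Rightarrow> real \<Rightarrow> real \<Rightarrow> real^'N \<Rightarrow> real" where
  "barrier_smoothness D \<rho> \<beta> \<beta>\<^sub>1 x\<^sub>0 =
     (let t = (barrier_obj D \<rho> x\<^sub>0 - real_of_ereal (opt_P D)) / \<rho>
      in (4 * \<beta>\<^sub>1\<^sup>2 * t ^ 3 + 2 * \<beta> * t\<^sup>2) * real (MAX i. nineq D i))"

end

theory Submission
  imports Defs
begin

text \<open>
  One iteration decreases \<open>F\<close> by at least \<open>\<parallel>\<nabla>F\<parallel>\<^sub>W\<^sup>2 / (2 M)\<close> with \<open>M = L + \<rho> L\<^sub>B\<close>;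
  all claims follow from this and from lower bounds on \<open>F\<close>.

  For the decrease, compare the solution of the subproblem of node \<open>j\<close> with the step \<open>-(1/M) P\<^sub>j \<nabla>F\<close>
  in its local null space. The subproblem minimises the model in which every \<open>f\<^sub>i\<close> is replaced by its
  quadratic majorant and the barrier is kept. The barrier has no bounded curvature, but where all
  reciprocals \<open>-1/g\<close> are at most \<open>\<tau>\<close>, each has a gradient with Lipschitz constant
  \<open>\<beta> \<tau>\<^sup>2 + 2 \<beta>\<^sub>1\<^sup>2 \<tau>\<^sup>3\<close> (\<open>reciprocal_derivative_lipschitz\<close>). In the sublevel set of the starting
  point one may take \<open>\<tau> = (F(x\<^sup>0) - f\<^sup>*)/\<rho>\<close>, because \<open>f \<ge> f\<^sup>*\<close> leaves no more than this for the
  whole barrier. The constant \<open>L\<^sub>B\<close> is twice the resulting bound, summed over the constraints of a block. That reserve allows a slightly larger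
  \<open>\<tau>\<close> and closes a continuation argument (\<open>model_decrease\<close>): as long as the reciprocals stay below the
  larger threshold, the model does not increase, hence \<open>F\<close> does not increase, hence the reciprocals
  stay below the smaller threshold. So the larger one is never reached on the comparison step.

  The weights \<open>\<eta>\<^sub>j\<close> seen by one node sum to at most \<open>1\<close>, so each block moves to a convex combination of
  its old position and the positions proposed by its neighbours. Convexity of the model then adds up
  the local decreases (\<open>iteration_decrease\<close>), and \<open>\<Sum> \<eta>\<^sub>j \<parallel>P\<^sub>j \<nabla>F\<parallel>\<^sup>2 = \<parallel>\<nabla>F\<parallel>\<^sub>W\<^sup>2\<close>. Telescoping gives the
  bound on the sum.

  For the rates, reachability makes \<open>W\<close> positive definite on the null space of \<open>A\<close>, which contains all
  differences of feasible points. There the least nonzero eigenvalue gives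
  \<open>\<lambda>\<^sub>W \<langle>\<nabla>F, z\<rangle>\<^sup>2 \<le> \<parallel>\<nabla>F\<parallel>\<^sub>W\<^sup>2 \<parallel>z\<parallel>\<^sup>2\<close> (\<open>spectral_gap_inner\<close>). Combined with the gradient inequality of
  \<open>F\<close> this bounds the optimality gap \<open>\<epsilon>\<close> by \<open>\<lambda>\<^sub>W \<epsilon>\<^sup>2 \<le> R\<^sup>2 \<parallel>\<nabla>F\<parallel>\<^sub>W\<^sup>2\<close> in the convex case and by
  \<open>2 \<sigma> \<lambda>\<^sub>W \<epsilon> \<le> \<parallel>\<nabla>F\<parallel>\<^sub>W\<^sup>2\<close> in the strongly convex case. Inserted into the decrease, these are the
  recurrences behind the rates \<open>O(1/k)\<close> and \<open>(1 - \<sigma> \<lambda>\<^sub>W / M)\<^sup>k\<close>.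
\<close>

section \<open>Calculus along lines of a subspace\<close>

lemma has_real_derivative_along_line:
  fixes h :: "'a::euclidean_space \<Rightarrow> real"
  assumes h: "(h has_derivative f') (at (x + s *\<^sub>R d) within S)"
    and S: "subspace S" "x \<in> S" "d \<in> S"
  shows "((\<lambda>s. h (x + s *\<^sub>R d)) has_real_derivative f' d) (at s)"
proof -
  have line: "((\<lambda>s. x + s *\<^sub>R d) has_derivative (\<lambda>t. t *\<^sub>R d)) (at s)"
    by (auto intro!: derivative_eq_intros)
  have "(h has_derivative f') (at (x + s *\<^sub>R d) within range (\<lambda>s. x + s *\<^sub>R d))"
    by (rule has_derivative_subset[OF h]) (use S in \<open>auto intro: subspace_add subspace_scale\<close>)
  with line have "((\<lambda>s. h (x + s *\<^sub>R d)) has_derivative (\<lambda>t. f' (t *\<^sub>R d))) (at s)"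
    by (rule has_derivative_in_compose)
  moreover have "f' (t *\<^sub>R d) = f' d * t" for t
    using has_derivative_linear[OF h] by (simp add: linear_scale)
  ultimately show ?thesis
    by (simp add: has_field_derivative_def)
qed

lemma grad_on_unique:
  fixes h :: "'a::euclidean_space \<Rightarrow> real"
  assumes S: "subspace S" "x \<in> S" and v: "v \<in> S"
    and h: "(h has_derivative (\<lambda>u. u \<bullet> v)) (at x within S)"
  shows "grad_on S h x = v"
  unfolding grad_on_def
proof (rule the_equality)
  fix w assume w: "w \<in> S \<and> (h has_derivative (\<lambda>u. u \<bullet> w)) (at x within S)"
  have "v - w \<in> S"
    using S v w by (auto intro: subspace_diff)
  then have "((\<lambda>s. h (x + s *\<^sub>R (v - w))) has_real_derivative (v - w) \<bullet> v) (at 0)"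
    "((\<lambda>s. h (x + s *\<^sub>R (v - w))) has_real_derivative (v - w) \<bullet> w) (at 0)"
    using h w S by (auto intro!: has_real_derivative_along_line)
  then have "(v - w) \<bullet> v = (v - w) \<bullet> w"
    by (rule DERIV_unique)
  then have "(v - w) \<bullet> (v - w) = 0"
    by (simp add: inner_diff_right)
  then show "w = v"
    by simp
qed (use v h in simp)

text \<open>
  A derivative along \<open>S\<close> is determined only on \<open>S\<close>; projecting a representing vector onto \<open>S\<close>
  removes the arbitrary part, which is why a gradient inside \<open>S\<close> always exists.
\<close>

lemma grad_on_derivative:
  fixes h :: "'a::euclidean_space \<Rightarrow> real"
  assumes S: "subspace S" "x \<in> S" and diff: "h differentiable (at x within S)"
  shows "grad_on S h x \<in> S"
    and "(h has_derivative (\<lambda>u. u \<bullet> grad_on S h x)) (at x within S)"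
proof -
  obtain f' where f': "(h has_derivative f') (at x within S)"
    using diff by (auto simp: differentiable_def)
  define w where "w = adjoint f' 1"
  have w: "f' u = u \<bullet> w" for u
    using adjoint_works[OF has_derivative_linear[OF f'], of u 1] by (simp add: w_def)
  obtain v z where v: "v \<in> span S" and z: "\<And>u. u \<in> span S \<Longrightarrow> orthogonal z u" and "w = v + z"
    using orthogonal_subspace_decomp_exists[of S w] by metis
  have vS: "v \<in> S"
    using v S by (simp add: span_eq_iff[THEN iffD2])
  have eq: "f' u = u \<bullet> v" if "u \<in> S" for u
    using z[of u] that \<open>w = v + z\<close> w[of u]
    by (simp add: span_base orthogonal_def inner_add_right inner_commute)
  have ev: "\<forall>\<^sub>F y in at x within S. norm (h y - h x - f' (y - x)) / norm (y - x)
      = norm (h y - h x - (y - x) \<bullet> v) / norm (y - x)"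
    unfolding eventually_at_filter using S eq subspace_diff[OF S(1) _ S(2)] by (auto intro!: always_eventually)
  then have v': "(h has_derivative (\<lambda>u. u \<bullet> v)) (at x within S)"
    using f' tendsto_cong[OF ev] unfolding has_derivative_iff_norm
    by (blast intro: bounded_linear_inner_left)
  show "grad_on S h x \<in> S" "(h has_derivative (\<lambda>u. u \<bullet> grad_on S h x)) (at x within S)"
    using grad_on_unique[OF S vS v'] vS v' by auto
qed

lemma abs_derivative_le_local_slope:
  fixes \<gamma> :: "real \<Rightarrow> real"
  assumes \<gamma>: "(\<gamma> has_real_derivative D) (at a)"
    and slope: "\<forall>\<^sub>F s in at a. \<bar>\<gamma> s - \<gamma> a\<bar> \<le> c * \<bar>s - a\<bar>"
  shows "\<bar>D\<bar> \<le> c"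
proof (rule tendsto_upperbound)
  show "((\<lambda>s. \<bar>(\<gamma> s - \<gamma> a) / (s - a)\<bar>) \<longlongrightarrow> \<bar>D\<bar>) (at a)"
    using \<gamma> unfolding has_field_derivative_iff by (rule tendsto_rabs)
  show "\<forall>\<^sub>F s in at a. \<bar>(\<gamma> s - \<gamma> a) / (s - a)\<bar> \<le> c"
    using slope eventually_neq_at_within[of a a UNIV]
    by eventually_elim (simp add: field_simps)
qed simp

text \<open>
  The derivative of \<open>\<phi>(a) - \<phi>'(0) a - K a\<^sup>2 / 2\<close> is nonpositive. Comparing the slopes with the one
  at \<open>0\<close> suffices, so the bound applies on an interval on which nothing else is known of \<open>\<phi>\<close>.
\<close>

lemma quadratic_upper_bound:
  fixes \<phi> \<phi>' :: "real \<Rightarrow> real"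
  assumes "0 \<le> s"
    and \<phi>: "\<And>a. 0 \<le> a \<Longrightarrow> a \<le> s \<Longrightarrow> (\<phi> has_real_derivative \<phi>' a) (at a)"
    and K: "\<And>a. 0 \<le> a \<Longrightarrow> a \<le> s \<Longrightarrow> \<phi>' a - \<phi>' 0 \<le> K * a"
  shows "\<phi> s \<le> \<phi> 0 + \<phi>' 0 * s + K / 2 * s\<^sup>2"
proof -
  define \<psi> where "\<psi> a = \<phi> a - \<phi>' 0 * a - K / 2 * a\<^sup>2" for a
  have "\<psi> s \<le> \<psi> 0"
  proof (rule DERIV_nonpos_imp_nonincreasing[OF \<open>0 \<le> s\<close>], intro exI conjI)
    fix a assume a: "0 \<le> a" "a \<le> s"
    show "(\<psi> has_real_derivative \<phi>' a - \<phi>' 0 - K * a) (at a)"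
      unfolding \<psi>_def by (rule derivative_eq_intros \<phi> a refl)+ simp
    show "\<phi>' a - \<phi>' 0 - K * a \<le> 0"
      using K[OF a] by simp
  qed
  then show ?thesis
    by (simp add: \<psi>_def)
qed

lemma smooth_fun_on_upper_bound:
  fixes h :: "'a::euclidean_space \<Rightarrow> real"
  assumes S: "subspace S" "y \<in> S" "u \<in> S" and h: "smooth_fun_on S l h"
  shows "h u \<le> h y + grad_on S h y \<bullet> (u - y) + l / 2 * (norm (u - y))\<^sup>2"
proof -
  let ?d = "u - y"
  have d: "?d \<in> S" "y + a *\<^sub>R ?d \<in> S" for a
    using S by (auto intro: subspace_add subspace_diff subspace_scale)
  have "h (y + 1 *\<^sub>R ?d) \<le> h (y + 0 *\<^sub>R ?d) + (?d \<bullet> grad_on S h (y + 0 *\<^sub>R ?d)) * 1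
      + (l * (norm ?d)\<^sup>2) / 2 * 1\<^sup>2"
  proof (rule quadratic_upper_bound)
    fix a :: real assume a: "0 \<le> a" "a \<le> 1"
    show "((\<lambda>a. h (y + a *\<^sub>R ?d)) has_real_derivative ?d \<bullet> grad_on S h (y + a *\<^sub>R ?d)) (at a)"
      using h S d by (intro has_real_derivative_along_line[where S = S] grad_on_derivative)
        (auto simp: smooth_fun_on_def)
    have "dist (grad_on S h (y + a *\<^sub>R ?d)) (grad_on S h y) \<le> l * dist (y + a *\<^sub>R ?d) y"
      using h S d by (auto simp: smooth_fun_on_def dest: lipschitz_onD)
    then have lip: "norm (grad_on S h (y + a *\<^sub>R ?d) - grad_on S h y) \<le> l * (a * norm ?d)"
      using a by (simp add: dist_norm)
    have "?d \<bullet> (grad_on S h (y + a *\<^sub>R ?d) - grad_on S h y)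
        \<le> norm ?d * norm (grad_on S h (y + a *\<^sub>R ?d) - grad_on S h y)"
      by (rule norm_cauchy_schwarz)
    also have "\<dots> \<le> norm ?d * (l * (a * norm ?d))"
      using lip by (rule mult_left_mono) simp
    finally show "?d \<bullet> grad_on S h (y + a *\<^sub>R ?d) - ?d \<bullet> grad_on S h (y + 0 *\<^sub>R ?d)
        \<le> l * (norm ?d)\<^sup>2 * a"
      by (simp add: inner_diff_right power2_eq_square algebra_simps)
  qed simp
  then show ?thesis
    by (simp add: inner_commute)
qed

lemma convex_on_gradient_inequality:
  fixes h :: "'a::euclidean_space \<Rightarrow> real"
  assumes conv: "convex_on S h" and xy: "x \<in> S" "y \<in> S"
    and f': "(h has_derivative f') (at x within S)"
  shows "h x + f' (y - x) \<le> h y"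
proof -
  let ?\<gamma> = "\<lambda>s::real. x + s *\<^sub>R (y - x)"
  have comb: "?\<gamma> s = (1 - s) *\<^sub>R x + s *\<^sub>R y" for s
    by (simp add: algebra_simps)
  have "convex S"
    using conv by (simp add: convex_on_def)
  then have sub: "?\<gamma> ` {0..1} \<subseteq> S"
    using xy by (auto simp: comb convexD)
  have line: "(?\<gamma> has_derivative (\<lambda>t. t *\<^sub>R (y - x))) (at 0 within {0..1})"
    by (auto intro!: derivative_eq_intros)
  have "(h has_derivative f') (at (?\<gamma> 0) within ?\<gamma> ` {0..1})"
    using has_derivative_subset[OF f' sub] by simp
  with line have "((\<lambda>s. h (?\<gamma> s)) has_derivative (\<lambda>t. f' (t *\<^sub>R (y - x)))) (at 0 within {0..1})"
    by (rule has_derivative_in_compose)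
  moreover have "f' (t *\<^sub>R (y - x)) = f' (y - x) * t" for t
    using has_derivative_linear[OF f'] by (simp add: linear_scale)
  ultimately have "((\<lambda>s. h (?\<gamma> s)) has_real_derivative f' (y - x)) (at 0 within {0..1})"
    by (simp add: has_field_derivative_def)
  then have lim: "((\<lambda>s. (h (?\<gamma> s) - h x) / s) \<longlongrightarrow> f' (y - x)) (at 0 within {0..1})"
    by (simp add: has_field_derivative_iff)
  have "(h (?\<gamma> s) - h x) / s \<le> h y - h x" if "s \<in> {0..1}" "s \<noteq> 0" for s
  proof -
    have "h (?\<gamma> s) \<le> (1 - s) * h x + s * h y"
      unfolding comb using conv xy that by (auto simp: convex_on_def)
    then show ?thesis
      using that by (subst pos_divide_le_eq) (auto simp: algebra_simps)
  qed
  then have "\<forall>\<^sub>F s in at 0 within {0..1}. (h (?\<gamma> s) - h x) / s \<le> h y - h x"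
    by (auto simp: eventually_at_filter intro!: always_eventually)
  with lim have "f' (y - x) \<le> h y - h x"
    by (rule tendsto_upperbound) (simp add: at_within_Icc_at_right)
  then show ?thesis
    by simp
qed

section \<open>The reciprocal barrier of one constraint\<close>

text \<open>
  With \<open>A = 1 / g\<^sub>1\<close> and \<open>B = 1 / g\<^sub>0\<close>, both of modulus at most \<open>\<tau>\<close>, the difference is
  \<open>(g\<^sub>1' - g\<^sub>0') A\<^sup>2 + g\<^sub>0' (A - B) (A + B)\<close>, and \<open>A - B = (g\<^sub>0 - g\<^sub>1) A B\<close>.
\<close>

lemma reciprocal_derivative_lipschitz:
  fixes g\<^sub>0 g\<^sub>1 g\<^sub>0' g\<^sub>1' :: real
  assumes \<tau>: "\<tau> > 0" and g: "g\<^sub>0 \<le> - 1 / \<tau>" "g\<^sub>1 \<le> - 1 / \<tau>"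
    and lip: "\<bar>g\<^sub>1 - g\<^sub>0\<bar> \<le> \<beta>\<^sub>1 * \<delta> * a" "\<bar>g\<^sub>1' - g\<^sub>0'\<bar> \<le> \<beta> * \<delta>\<^sup>2 * a" "\<bar>g\<^sub>0'\<bar> \<le> \<beta>\<^sub>1 * \<delta>"
    and "a \<ge> 0"
  shows "\<bar>g\<^sub>1' / g\<^sub>1\<^sup>2 - g\<^sub>0' / g\<^sub>0\<^sup>2\<bar> \<le> (\<beta> * \<tau>\<^sup>2 + 2 * \<beta>\<^sub>1\<^sup>2 * \<tau> ^ 3) * \<delta>\<^sup>2 * a"
proof -
  define A B where "A = 1 / g\<^sub>1" and "B = 1 / g\<^sub>0"
  have neg: "g\<^sub>0 < 0" "g\<^sub>1 < 0"
    using g \<tau> by (auto intro: le_less_trans)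
  have A: "\<bar>A\<bar> \<le> \<tau>" and B: "\<bar>B\<bar> \<le> \<tau>"
    using g neg \<tau> by (auto simp: A_def B_def field_simps)
  have "A - B = (g\<^sub>0 - g\<^sub>1) * (A * B)"
    using neg by (simp add: A_def B_def field_simps)
  then have "\<bar>A - B\<bar> = \<bar>g\<^sub>1 - g\<^sub>0\<bar> * (\<bar>A\<bar> * \<bar>B\<bar>)"
    by (simp add: abs_mult abs_minus_commute)
  also have "\<dots> \<le> (\<beta>\<^sub>1 * \<delta> * a) * (\<tau> * \<tau>)"
    using lip A B \<tau> by (intro mult_mono) auto
  finally have AB: "\<bar>A - B\<bar> \<le> (\<beta>\<^sub>1 * \<delta> * a) * (\<tau> * \<tau>)" .
  have 1: "\<bar>(g\<^sub>1' - g\<^sub>0') * A\<^sup>2\<bar> \<le> (\<beta> * \<delta>\<^sup>2 * a) * \<tau>\<^sup>2"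
    unfolding abs_mult using lip power_mono[OF A, of 2] by (intro mult_mono) auto
  have "\<bar>g\<^sub>0' * ((A - B) * (A + B))\<bar> = \<bar>g\<^sub>0'\<bar> * (\<bar>A - B\<bar> * \<bar>A + B\<bar>)"
    by (simp add: abs_mult)
  also have "\<dots> \<le> (\<beta>\<^sub>1 * \<delta>) * ((\<beta>\<^sub>1 * \<delta> * a * (\<tau> * \<tau>)) * (2 * \<tau>))"
    using lip AB A B \<tau> by (intro mult_mono) auto
  finally have 2: "\<bar>g\<^sub>0' * ((A - B) * (A + B))\<bar> \<le> 2 * \<beta>\<^sub>1\<^sup>2 * \<tau> ^ 3 * \<delta>\<^sup>2 * a"
    by (simp add: power2_eq_square power3_eq_cube algebra_simps)
  have "g\<^sub>1' / g\<^sub>1\<^sup>2 = g\<^sub>1' * A\<^sup>2" "g\<^sub>0' / g\<^sub>0\<^sup>2 = g\<^sub>0' * B\<^sup>2"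
    by (simp_all add: A_def B_def power_divide)
  then have "g\<^sub>1' / g\<^sub>1\<^sup>2 - g\<^sub>0' / g\<^sub>0\<^sup>2 = (g\<^sub>1' - g\<^sub>0') * A\<^sup>2 + g\<^sub>0' * ((A - B) * (A + B))"
    by (simp add: power2_eq_square algebra_simps)
  then have "\<bar>g\<^sub>1' / g\<^sub>1\<^sup>2 - g\<^sub>0' / g\<^sub>0\<^sup>2\<bar> \<le> \<bar>(g\<^sub>1' - g\<^sub>0') * A\<^sup>2\<bar> + \<bar>g\<^sub>0' * ((A - B) * (A + B))\<bar>"
    by simp
  with 1 2 show ?thesis
    by (simp add: algebra_simps)
qed

lemma convex_on_neg_reciprocal:
  assumes g: "convex_on S g" and neg: "\<And>u. u \<in> S \<Longrightarrow> g u < 0"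
  shows "convex_on S (\<lambda>u. - 1 / g u)"
proof (rule convex_onI)
  fix t :: real and u v assume t: "0 < t" "t < 1" and uv: "u \<in> S" "v \<in> S"
  let ?w = "(1 - t) *\<^sub>R u + t *\<^sub>R v"
  have "?w \<in> S"
    using g t uv by (auto simp: convex_on_def convexD)
  have "g ?w \<le> (1 - t) * g u + t * g v"
    using g t uv by (auto intro: convex_onD)
  then have le: "(1 - t) * (- g u) + t * (- g v) \<le> - g ?w"
    by simp
  have pos: "0 < (1 - t) * (- g u) + t * (- g v)"
    using t neg uv by (intro add_pos_pos mult_pos_pos) auto
  have "- 1 / g ?w = inverse (- g ?w)"
    by (simp add: divide_inverse)
  also have "\<dots> \<le> inverse ((1 - t) * (- g u) + t * (- g v))"
    using le pos by (rule le_imp_inverse_le)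
  also have "\<dots> \<le> (1 - t) * inverse (- g u) + t * inverse (- g v)"
    using convex_onD[OF convex_on_inverse[of "{0<..}"], of t "- g u" "- g v"] t uv neg by auto
  finally show "- 1 / g ?w \<le> (1 - t) * (- 1 / g u) + t * (- 1 / g v)"
    by (simp add: divide_inverse)
qed (use g in \<open>simp add: convex_on_def\<close>)

lemma convex_on_sum_functions:
  fixes h :: "'i \<Rightarrow> 'a::real_vector \<Rightarrow> real"
  assumes "convex S" and h: "\<And>i. i \<in> I \<Longrightarrow> convex_on S (h i)"
  shows "convex_on S (\<lambda>x. \<Sum>i\<in>I. h i x)"
  using h
  by (induction I rule: infinite_finite_induct) (auto simp: convex_on_const \<open>convex S\<close>)

section \<open>Convex functions at damped displacements\<close>

text \<open>
  Weights whose sum is below \<open>1\<close> leave the rest of the mass at the base point. Measured from the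
  base point, Jensen's inequality then needs no term for that rest.
\<close>

lemma convex_on_damped_displacement:
  assumes h: "convex_on C h" and x: "x \<in> C" and J: "finite J"
    and w: "\<And>j. j \<in> J \<Longrightarrow> 0 \<le> w j" "sum w J \<le> (1::real)"
    and p: "\<And>j. j \<in> J \<Longrightarrow> x + p j \<in> C"
  shows "x + (\<Sum>j\<in>J. w j *\<^sub>R p j) \<in> C"
    and "h (x + (\<Sum>j\<in>J. w j *\<^sub>R p j)) \<le> h x + (\<Sum>j\<in>J. w j * (h (x + p j) - h x))"
proof -
  (* None stands for the base point, which receives the remaining weight. *)
  define I where "I = insert None (Some ` J)"
  define a where "a = case_option (1 - sum w J) w"
  define y where "y = case_option x (\<lambda>j. x + p j)"
  have split: "(\<Sum>i\<in>I. q i) = q None + (\<Sum>j\<in>J. q (Some j))" for q :: "'b option \<Rightarrow> real"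
    using J by (simp add: I_def sum.reindex)
  have I: "finite I" "I \<noteq> {}" and a: "sum a I = 1" "\<And>i. i \<in> I \<Longrightarrow> 0 \<le> a i"
    and y: "\<And>i. i \<in> I \<Longrightarrow> y i \<in> C"
    using J w x p split[of a] by (auto simp: I_def a_def y_def)
  have pt: "(\<Sum>i\<in>I. a i *\<^sub>R y i) = x + (\<Sum>j\<in>J. w j *\<^sub>R p j)"
    unfolding I_def using J
    by (simp add: sum.reindex a_def y_def scaleR_add_right sum.distrib algebra_simps scaleR_sum_left[symmetric])
  have val: "(\<Sum>i\<in>I. a i * h (y i)) = h x + (\<Sum>j\<in>J. w j * (h (x + p j) - h x))"
    unfolding split by (simp add: a_def y_def algebra_simps sum.distrib sum_subtractf sum_distrib_left)
  show "x + (\<Sum>j\<in>J. w j *\<^sub>R p j) \<in> C"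
    unfolding pt[symmetric] using h I a y by (intro convex_sum) (auto simp: convex_on_def)
  show "h (x + (\<Sum>j\<in>J. w j *\<^sub>R p j)) \<le> h x + (\<Sum>j\<in>J. w j * (h (x + p j) - h x))"
    unfolding pt[symmetric] val[symmetric] using I h a y by (rule convex_on_sum)
qed

section \<open>Orthogonal projections and the spectral gap of their weighted sum\<close>

lemma orthogonal_residual_unique:
  fixes S :: "'a::euclidean_space set"
  assumes S: "subspace S" and yz: "y \<in> S" "z \<in> S"
    and orth: "\<And>s. s \<in> S \<Longrightarrow> (x - y) \<bullet> s = 0" "\<And>s. s \<in> S \<Longrightarrow> (x - z) \<bullet> s = 0"
  shows "y = z"
proof -
  have "y - z \<in> S"
    using S yz by (rule subspace_diff)
  then have "(x - y) \<bullet> (y - z) = 0" "(x - z) \<bullet> (y - z) = 0"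
    using orth by auto
  then have "(y - z) \<bullet> (y - z) = 0"
    by (simp add: inner_diff_left)
  then show ?thesis
    by simp
qed

lemma orth_proj_matrix_unique:
  fixes S :: "(real^'n::finite) set"
  assumes S: "subspace S" and P: "\<And>x. P *v x \<in> S" "\<And>x s. s \<in> S \<Longrightarrow> orthogonal (x - P *v x) s"
  shows "orth_proj_matrix S = P"
  unfolding orth_proj_matrix_def
proof (rule the_equality)
  fix Q :: "real^'n^'n"
  assume Q: "\<forall>x. Q *v x \<in> S \<and> (\<forall>s\<in>S. orthogonal (x - Q *v x) s)"
  have "Q *v x = P *v x" for x
    using S P Q by (intro orthogonal_residual_unique[of S _ _ x]) (auto simp: orthogonal_def)
  then show "Q = P"
    by (simp add: matrix_eq)
qed (use P in auto)

lemma
  fixes S :: "(real^'n::finite) set"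
  assumes S: "subspace S"
  shows orth_proj_matrix_in: "orth_proj_matrix S *v x \<in> S"
    and inner_orth_proj_matrix: "s \<in> S \<Longrightarrow> s \<bullet> (orth_proj_matrix S *v x) = s \<bullet> x"
proof -
  have "\<exists>y\<in>S. \<forall>s\<in>S. orthogonal (x - y) s" for x :: "real^'n"
  proof -
    obtain y z where "y \<in> span S" "\<And>w. w \<in> span S \<Longrightarrow> orthogonal z w" "x = y + z"
      using orthogonal_subspace_decomp_exists[of S x] by metis
    then show ?thesis
      using S by (intro bexI[of _ y]) (auto simp: span_base span_eq_iff[THEN iffD2])
  qed
  then obtain p where p: "\<And>x. p x \<in> S" "\<And>x s. s \<in> S \<Longrightarrow> (x - p x) \<bullet> s = 0"
    unfolding orthogonal_def by metis
  have unique: "p x = y" if "y \<in> S" "\<And>s. s \<in> S \<Longrightarrow> (x - y) \<bullet> s = 0" for x y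
    using S p(1) that(1) p(2) that(2) by (rule orthogonal_residual_unique)
  have "linear p"
  proof (rule linearI)
    fix u v show "p (u + v) = p u + p v"
    proof (rule unique)
      fix s assume "s \<in> S"
      then show "(u + v - (p u + p v)) \<bullet> s = 0"
        using p(2)[of s u] p(2)[of s v] by (simp add: algebra_simps)
    qed (use S p in \<open>auto intro: subspace_add\<close>)
  next
    fix r u show "p (r *\<^sub>R u) = r *\<^sub>R p u"
    proof (rule unique)
      fix s assume "s \<in> S"
      then show "(r *\<^sub>R u - r *\<^sub>R p u) \<bullet> s = 0"
        using p(2)[of s u] by (simp add: algebra_simps)
    qed (use S p in \<open>auto intro: subspace_scale\<close>)
  qed
  then have mat: "matrix p *v u = p u" for u
    by (metis matrix_vector_mul(2))
  have P: "orth_proj_matrix S = matrix p"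
    using p by (intro orth_proj_matrix_unique[OF S]) (auto simp: mat orthogonal_def)
  show "orth_proj_matrix S *v x \<in> S"
    unfolding P mat by (rule p)
  show "s \<bullet> (orth_proj_matrix S *v x) = s \<bullet> x" if "s \<in> S"
    unfolding P mat using p(2)[OF that, of x] by (simp add: algebra_simps inner_commute)
qed

lemma orth_proj_matrix_eqI:
  fixes S :: "(real^'n::finite) set"
  assumes S: "subspace S" and y: "y \<in> S" "\<And>s. s \<in> S \<Longrightarrow> s \<bullet> y = s \<bullet> x"
  shows "orth_proj_matrix S *v x = y"
proof (rule orthogonal_residual_unique[OF S orth_proj_matrix_in[OF S] y(1)])
  fix s assume s: "s \<in> S"
  show "(x - orth_proj_matrix S *v x) \<bullet> s = 0"
    using inner_orth_proj_matrix[OF S s, of x] by (simp add: inner_commute[of _ s] inner_diff_right)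
  show "(x - y) \<bullet> s = 0"
    using y(2)[OF s] by (simp add: inner_commute[of _ s] inner_diff_right)
qed

lemma orth_proj_matrix_selfadjoint:
  fixes S :: "(real^'n::finite) set"
  assumes "subspace S"
  shows "u \<bullet> (orth_proj_matrix S *v v) = (orth_proj_matrix S *v u) \<bullet> v"
  by (metis assms inner_commute inner_orth_proj_matrix orth_proj_matrix_in)

lemma inner_orth_proj_matrix_self:
  fixes S :: "(real^'n::finite) set"
  assumes "subspace S"
  shows "x \<bullet> (orth_proj_matrix S *v x) = (norm (orth_proj_matrix S *v x))\<^sup>2"
  by (metis assms inner_commute inner_orth_proj_matrix orth_proj_matrix_in power2_norm_eq_inner)

lemma sum_matrix_vector_mult:
  fixes M :: "'i \<Rightarrow> real^'n::finite^'m::finite"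
  shows "(\<Sum>i\<in>I. M i) *v x = (\<Sum>i\<in>I. M i *v x)"
  by (induction I rule: infinite_finite_induct) (simp_all add: matrix_vector_mult_add_rdistrib)

lemma finite_eigenvalues_selfadjoint:
  fixes M :: "real^'n::finite^'n"
  assumes M: "\<And>u v. u \<bullet> (M *v v) = (M *v u) \<bullet> v"
  shows "finite (eigenvalues M)"
proof -
  have "\<forall>\<mu>\<in>eigenvalues M. \<exists>v. v \<noteq> 0 \<and> M *v v = \<mu> *\<^sub>R v"
    by (simp add: eigenvalues_def)
  then obtain e where e: "\<And>\<mu>. \<mu> \<in> eigenvalues M \<Longrightarrow> e \<mu> \<noteq> 0 \<and> M *v e \<mu> = \<mu> *\<^sub>R e \<mu>"
    by metis
  (* Eigenvectors of different eigenvalues are orthogonal, hence independent. *)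
  have orth: "e \<mu> \<bullet> e \<nu> = 0" if "\<mu> \<in> eigenvalues M" "\<nu> \<in> eigenvalues M" "\<mu> \<noteq> \<nu>" for \<mu> \<nu>
    using M[of "e \<mu>" "e \<nu>"] e that by auto
  have "inj_on e (eigenvalues M)"
    by (rule inj_onI) (metis e orth inner_eq_zero_iff)
  moreover have "independent (e ` eigenvalues M)"
    using e orth by (intro pairwise_orthogonal_independent) (auto simp: pairwise_def orthogonal_def)
  ultimately show ?thesis
    using finiteI_independent finite_imageD by blast
qed

text \<open>
  The smallest value of \<open>z \<bullet> M z\<close> on the unit sphere of an invariant subspace is attained at an
  eigenvector, so it is an eigenvalue and, being positive, one of those over which the least is
  taken.
\<close>

lemma least_nonzero_eigenvalue_bound:
  fixes M :: "real^'n::finite^'n"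
  assumes M: "\<And>u v. u \<bullet> (M *v v) = (M *v u) \<bullet> v"
    and T: "subspace T" "\<And>z. M *v z \<in> T" "T \<noteq> {0}"
    and pos: "\<And>z. z \<in> T \<Longrightarrow> z \<noteq> 0 \<Longrightarrow> 0 < z \<bullet> (M *v z)"
  shows "0 < least_nonzero_eigenvalue M"
    and "z \<in> T \<Longrightarrow> least_nonzero_eigenvalue M * (norm z)\<^sup>2 \<le> z \<bullet> (M *v z)"
proof -
  let ?E = "{\<mu> \<in> eigenvalues M. \<mu> \<noteq> 0}"
  have pos_eigenvalue: "0 < \<mu>" if "\<mu> \<in> ?E" for \<mu>
  proof -
    obtain v where v: "v \<noteq> 0" "M *v v = \<mu> *\<^sub>R v" and "\<mu> \<noteq> 0"
      using \<open>\<mu> \<in> ?E\<close> by (auto simp: eigenvalues_def)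
    then have "v = (1 / \<mu>) *\<^sub>R (M *v v)"
      by simp
    then have "v \<in> T"
      using T by (metis subspace_scale)
    then have "0 < \<mu> * (v \<bullet> v)"
      using pos[of v] v by simp
    then show ?thesis
      using inner_ge_zero[of v] by (simp add: zero_less_mult_iff)
  qed
  obtain z0 where z0: "z0 \<in> T" "z0 \<noteq> 0"
    using T subspace_0 by blast
  have "compact (T \<inter> sphere 0 1)"
    using T by (intro closed_Int_compact closed_subspace compact_sphere)
  moreover have "(1 / norm z0) *\<^sub>R z0 \<in> T \<inter> sphere 0 1"
    using T z0 by (auto intro: subspace_scale)
  moreover have "continuous_on (T \<inter> sphere 0 1) (\<lambda>z. z \<bullet> (M *v z))"
    by (intro continuous_intros matrix_vector_mult_linear_continuous_on)
  ultimately obtain v where v: "v \<in> T \<inter> sphere 0 1"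
    and min: "\<And>z. z \<in> T \<inter> sphere 0 1 \<Longrightarrow> v \<bullet> (M *v v) \<le> z \<bullet> (M *v z)"
    using continuous_attains_inf[of "T \<inter> sphere 0 1" "\<lambda>z. z \<bullet> (M *v z)"]
    by (metis empty_iff)
  define \<mu> where "\<mu> = v \<bullet> (M *v v)"
  define q where "q z = z \<bullet> (M *v z) - \<mu> * (z \<bullet> z)" for z
  have q: "0 \<le> q z" if "z \<in> T" for z
  proof (cases "z = 0")
    case False
    then have "\<mu> \<le> ((1 / norm z) *\<^sub>R z) \<bullet> (M *v ((1 / norm z) *\<^sub>R z))"
      unfolding \<mu>_def using T that by (intro min) (auto intro: subspace_scale)
    also have "\<dots> = z \<bullet> (M *v z) / (norm z)\<^sup>2"
      by (simp add: matrix_vector_mult_scaleR power2_eq_square)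
    finally have "\<mu> * (norm z)\<^sup>2 \<le> z \<bullet> (M *v z)"
      using False by (simp add: le_divide_eq)
    then show ?thesis
      by (simp add: q_def power2_norm_eq_inner)
  qed (simp add: q_def)
  have vv: "v \<bullet> v = 1" "v \<in> T"
    using v by (auto simp: power2_norm_eq_inner[symmetric])
  (* First-order optimality at v, tested in the direction w of the residual itself. *)
  define w where "w = M *v v - \<mu> *\<^sub>R v"
  have wT: "w \<in> T"
    unfolding w_def using T vv by (auto intro: subspace_diff subspace_scale)
  define b where "b = w \<bullet> w"
  have expand: "q (v + s *\<^sub>R w) = 2 * s * b + s\<^sup>2 * q w" for s
  proof -
    have "v \<bullet> (M *v w) = w \<bullet> (M *v v)"
      using M[of v w] by (simp add: inner_commute)
    then have "q (v + s *\<^sub>R w) = q v + 2 * s * (w \<bullet> (M *v v) - \<mu> * (w \<bullet> v)) + s\<^sup>2 * q w"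
      by (simp add: q_def matrix_vector_right_distrib matrix_vector_mult_scaleR inner_add_left
          inner_add_right inner_commute[of v w] power2_eq_square algebra_simps)
    moreover have "w \<bullet> (M *v v) - \<mu> * (w \<bullet> v) = b"
      unfolding b_def w_def by (simp add: inner_diff_right)
    moreover have "q v = 0"
      using vv by (simp add: q_def \<mu>_def)
    ultimately show ?thesis
      by simp
  qed
  have "b = 0"
  proof (rule ccontr)
    assume "b \<noteq> 0"
    (* A small step of the sign of -b makes the linear term dominate, since q w >= 0. *)
    let ?s = "- b / (q w + 1)"
    have "v + ?s *\<^sub>R w \<in> T"
      using T(1) vv wT by (intro subspace_add subspace_scale)
    then have "0 \<le> 2 * ?s * b + ?s\<^sup>2 * q w"
      unfolding expand[symmetric] by (rule q)
    moreover have "2 * ?s * b + ?s\<^sup>2 * q w = - b\<^sup>2 * (q w + 2) / (q w + 1)\<^sup>2"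
      using q[OF wT] by (simp add: divide_simps power2_eq_square) (simp add: algebra_simps)
    moreover have "0 < b\<^sup>2 * (q w + 2) / (q w + 1)\<^sup>2"
      using q[OF wT] \<open>b \<noteq> 0\<close> by (intro divide_pos_pos mult_pos_pos) auto
    ultimately show False
      by simp
  qed
  then have "M *v v = \<mu> *\<^sub>R v"
    by (simp add: b_def w_def)
  moreover have "v \<noteq> 0"
    using vv by auto
  moreover have "0 < \<mu>"
    unfolding \<mu>_def using vv \<open>v \<noteq> 0\<close> by (intro pos) auto
  ultimately have \<mu>: "\<mu> \<in> ?E"
    by (auto simp: eigenvalues_def)
  have fin: "finite ?E"
    using finite_eigenvalues_selfadjoint[OF M] by simp
  then have "least_nonzero_eigenvalue M \<in> ?E"
    unfolding least_nonzero_eigenvalue_def using \<mu> by (intro Min_in) auto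
  then show "0 < least_nonzero_eigenvalue M"
    by (rule pos_eigenvalue)
  have "least_nonzero_eigenvalue M \<le> \<mu>"
    unfolding least_nonzero_eigenvalue_def using \<mu> fin by (intro Min_le) auto
  then have "least_nonzero_eigenvalue M * (norm z)\<^sup>2 \<le> \<mu> * (norm z)\<^sup>2"
    by (rule mult_right_mono) simp
  also have "\<dots> \<le> z \<bullet> (M *v z)" if "z \<in> T"
    using q[OF that] by (simp add: q_def power2_norm_eq_inner)
  finally show "z \<in> T \<Longrightarrow> least_nonzero_eigenvalue M * (norm z)\<^sup>2 \<le> z \<bullet> (M *v z)" .
qed

text \<open>
  The form \<open>z \<bullet> W z\<close> of a positive combination of projections is the weighted sum of the squared
  lengths of the projections of \<open>z\<close>.
\<close>

locale weighted_projections =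
  fixes S :: "'i::finite \<Rightarrow> (real^'n::finite) set" and w :: "'i \<Rightarrow> real" and T W
  assumes S: "\<And>i. subspace (S i)"
    and w: "\<And>i. 0 < w i"
    and T: "(\<Sum>i\<in>UNIV. S i) = T"
    and W: "W = (\<Sum>i\<in>UNIV. w i *\<^sub>R orth_proj_matrix (S i))"
begin

lemma W_mult: "W *v x = (\<Sum>i\<in>UNIV. w i *\<^sub>R (orth_proj_matrix (S i) *v x))"
  by (simp add: W sum_matrix_vector_mult scaleR_matrix_vector_assoc)

lemma inner_W_self: "x \<bullet> (W *v x) = (\<Sum>i\<in>UNIV. w i * (norm (orth_proj_matrix (S i) *v x))\<^sup>2)"
  by (simp add: W_mult inner_sum_right inner_orth_proj_matrix_self S)

lemma inner_W_nonneg: "0 \<le> x \<bullet> (W *v x)"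
  unfolding inner_W_self using w by (intro sum_nonneg mult_nonneg_nonneg) (auto intro: less_imp_le)

lemma mem_T_iff: "z \<in> T \<longleftrightarrow> (\<exists>u. (\<forall>i. u i \<in> S i) \<and> z = (\<Sum>i\<in>UNIV. u i))"
  unfolding T[symmetric] set_sum_alt[OF finite] by auto

lemma subspace_T: "subspace T"
  unfolding subspace_def
proof (intro conjI ballI allI)
  show "0 \<in> T"
    unfolding mem_T_iff using S by (intro exI[of _ "\<lambda>_. 0"]) (simp add: subspace_0)
next
  fix y z assume "y \<in> T" "z \<in> T"
  then obtain u v where "\<forall>i. u i \<in> S i" "y = (\<Sum>i\<in>UNIV. u i)" "\<forall>i. v i \<in> S i" "z = (\<Sum>i\<in>UNIV. v i)"
    by (auto simp: mem_T_iff)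
  then show "y + z \<in> T"
    unfolding mem_T_iff using S
    by (intro exI[of _ "\<lambda>i. u i + v i"]) (simp add: sum.distrib subspace_add)
next
  fix r z assume "z \<in> T"
  then obtain u where "\<forall>i. u i \<in> S i" "z = (\<Sum>i\<in>UNIV. u i)"
    by (auto simp: mem_T_iff)
  then show "r *\<^sub>R z \<in> T"
    unfolding mem_T_iff using S
    by (intro exI[of _ "\<lambda>i. r *\<^sub>R u i"]) (simp add: scaleR_sum_right subspace_scale)
qed

lemma S_subset_T: "S i \<subseteq> T"
proof
  fix z assume "z \<in> S i"
  then show "z \<in> T"
    unfolding mem_T_iff using S
    by (intro exI[of _ "\<lambda>j. if j = i then z else 0"]) (auto simp: subspace_0)
qed

lemma W_mult_in_T: "W *v z \<in> T"
  unfolding mem_T_iff W_mult using S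
  by (intro exI[of _ "\<lambda>i. w i *\<^sub>R (orth_proj_matrix (S i) *v z)"])
    (simp add: subspace_scale orth_proj_matrix_in)

lemma W_selfadjoint: "u \<bullet> (W *v v) = (W *v u) \<bullet> v"
  by (simp add: W_mult inner_sum_left inner_sum_right orth_proj_matrix_selfadjoint S)

text \<open>
  If the form vanishes at \<open>z\<close>, then \<open>z\<close> is orthogonal to every \<open>S i\<close>, hence to their sum, to which
  it belongs.
\<close>

lemma inner_W_pos:
  assumes z: "z \<in> T" "z \<noteq> 0"
  shows "0 < z \<bullet> (W *v z)"
proof (rule ccontr)
  assume "\<not> 0 < z \<bullet> (W *v z)"
  then have "(\<Sum>i\<in>UNIV. w i * (norm (orth_proj_matrix (S i) *v z))\<^sup>2) = 0"
    using inner_W_nonneg[of z] by (simp add: inner_W_self)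
  then have zero: "w i * (norm (orth_proj_matrix (S i) *v z))\<^sup>2 = 0" for i
    using less_imp_le[OF w] by (subst (asm) sum_nonneg_eq_0_iff) auto
  have proj: "orth_proj_matrix (S i) *v z = 0" for i
    using zero[of i] w[of i] by simp
  obtain u where u: "\<forall>i. u i \<in> S i" "z = (\<Sum>i\<in>UNIV. u i)"
    using z by (auto simp: mem_T_iff)
  have "z \<bullet> z = (\<Sum>i\<in>UNIV. u i \<bullet> z)"
    using u by (simp add: inner_sum_left[symmetric])
  also have "\<dots> = 0"
    using u proj S inner_orth_proj_matrix[of "S _" "u _" z] by (intro sum.neutral) (metis inner_zero_right)
  finally show False
    using z by simp
qed

text \<open>
  Only the component of \<open>g\<close> in \<open>T\<close> contributes to either side, and on \<open>T\<close> the form is bounded below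
  by the least nonzero eigenvalue.
\<close>

lemma spectral_gap_inner:
  assumes z: "z \<in> T" "T \<noteq> {0}"
  shows "0 < least_nonzero_eigenvalue W"
    and "least_nonzero_eigenvalue W * (g \<bullet> z)\<^sup>2 \<le> g \<bullet> (W *v g) * (norm z)\<^sup>2"
proof -
  let ?lam = "least_nonzero_eigenvalue W"
  define h where "h = orth_proj_matrix T *v g"
  have h: "h \<in> T" "\<And>s. s \<in> T \<Longrightarrow> s \<bullet> h = s \<bullet> g"
    unfolding h_def using subspace_T by (auto simp: orth_proj_matrix_in inner_orth_proj_matrix)
  note gap = least_nonzero_eigenvalue_bound[OF W_selfadjoint subspace_T W_mult_in_T z(2)]
  show pos: "0 < ?lam"
    by (rule gap) (rule inner_W_pos)
  have "orth_proj_matrix (S i) *v g = orth_proj_matrix (S i) *v h" for i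
    using S S_subset_T[of i] h
    by (intro orth_proj_matrix_eqI) (auto simp: orth_proj_matrix_in inner_orth_proj_matrix)
  then have Wh: "g \<bullet> (W *v g) = h \<bullet> (W *v h)"
    by (simp add: inner_W_self)
  have "?lam * (g \<bullet> z)\<^sup>2 = ?lam * (h \<bullet> z)\<^sup>2"
    using h(2)[OF z(1)] by (simp add: inner_commute)
  also have "\<dots> \<le> ?lam * ((norm h)\<^sup>2 * (norm z)\<^sup>2)"
    using pos Cauchy_Schwarz_ineq[of h z] by (simp add: power2_norm_eq_inner)
  also have "\<dots> \<le> g \<bullet> (W *v g) * (norm z)\<^sup>2"
    unfolding Wh mult.assoc[symmetric] using gap(2)[OF inner_W_pos h(1)] by (intro mult_right_mono) auto
  finally show "?lam * (g \<bullet> z)\<^sup>2 \<le> g \<bullet> (W *v g) * (norm z)\<^sup>2" .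
qed

end

section \<open>Recurrences and optimal values\<close>

text \<open>
  In terms of \<open>y = a * \<epsilon> k\<close> the step is \<open>y \<mapsto> y (1 - y)\<close>, which preserves the bound \<open>y \<le> 1 / k\<close>.
\<close>

lemma quadratic_decrease_rate:
  fixes \<epsilon> :: "nat \<Rightarrow> real"
  assumes a: "0 \<le> a" and nonneg: "\<And>k. 0 \<le> \<epsilon> k"
    and step: "\<And>k. \<epsilon> (Suc k) \<le> \<epsilon> k - a * (\<epsilon> k)\<^sup>2"
  shows "real k * (a * \<epsilon> k) \<le> 1"
proof (induction k)
  case (Suc k)
  define y where "y = a * \<epsilon> k"
  have y: "0 \<le> y"
    using a nonneg by (simp add: y_def)
  have IH: "real k * y \<le> 1"
    using Suc by (simp add: y_def)
  have "a * \<epsilon> (Suc k) \<le> a * (\<epsilon> k - a * (\<epsilon> k)\<^sup>2)"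
    using step a by (rule mult_left_mono)
  also have "\<dots> = y * (1 - y)"
    by (simp add: y_def power2_eq_square algebra_simps)
  finally have "real (Suc k) * (a * \<epsilon> (Suc k)) \<le> real (Suc k) * (y * (1 - y))"
    by (rule mult_left_mono) simp
  also have "\<dots> \<le> 1"
  proof (cases "real (Suc k) * y \<le> 1")
    case True
    have "real (Suc k) * (y * (1 - y)) = real (Suc k) * y - real (Suc k) * y\<^sup>2"
      by (simp add: power2_eq_square algebra_simps)
    also have "\<dots> \<le> real (Suc k) * y"
      by simp
    finally show ?thesis
      using True by linarith
  next
    case False
    then have "real (Suc k) * (1 - y) \<le> real k"
      by (simp add: algebra_simps)
    then have "y * (real (Suc k) * (1 - y)) \<le> y * real k"
      using y by (rule mult_left_mono)
    then show ?thesis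
      using IH by (simp add: algebra_simps)
  qed
  finally show ?case .
qed simp

text \<open>
  If the factor \<open>r\<close> is negative, the sequence can stay nonnegative only by being zero from the start.
\<close>

lemma linear_decrease_rate:
  fixes \<epsilon> :: "nat \<Rightarrow> real"
  assumes nonneg: "\<And>k. 0 \<le> \<epsilon> k" and step: "\<And>k. \<epsilon> (Suc k) \<le> r * \<epsilon> k"
  shows "\<epsilon> k \<le> r ^ k * \<epsilon> 0"
proof (cases "r < 0")
  case True
  have "\<epsilon> k = 0" for k
  proof (rule ccontr)
    assume "\<epsilon> k \<noteq> 0"
    then have "r * \<epsilon> k < 0"
      using True nonneg[of k] by (simp add: mult_neg_pos)
    with step[of k] nonneg[of "Suc k"] show False
      by linarith
  qed
  then show ?thesis
    by simp
next
  case False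
  show ?thesis
  proof (induction k)
    case (Suc k)
    have "\<epsilon> (Suc k) \<le> r * \<epsilon> k"
      by (rule step)
    also have "\<dots> \<le> r * (r ^ k * \<epsilon> 0)"
      using False Suc by (intro mult_left_mono) auto
    finally show ?case
      by simp
  qed simp
qed

lemma opt_value_le:
  assumes "opt_value S h > - \<infinity>" "y \<in> S"
  shows "real_of_ereal (opt_value S h) \<le> h y"
proof -
  have "opt_value S h \<le> ereal (h y)"
    unfolding opt_value_def using assms by (auto intro: INF_lower)
  with assms(1) show ?thesis
    by (cases "opt_value S h") auto
qed

lemma opt_value_bounded_below:
  assumes "\<And>y. y \<in> S \<Longrightarrow> c \<le> h y"
  shows "opt_value S h > - \<infinity>"
    and "S \<noteq> {} \<Longrightarrow> c \<le> real_of_ereal (opt_value S h)"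
proof -
  have le: "ereal c \<le> opt_value S h"
    unfolding opt_value_def using assms by (auto intro: INF_greatest)
  then show fin: "opt_value S h > - \<infinity>"
    by (auto intro: less_le_trans[rotated])
  assume "S \<noteq> {}"
  then obtain y where "y \<in> S"
    by blast
  then have "opt_value S h \<le> ereal (h y)"
    unfolding opt_value_def by (auto intro: INF_lower)
  with le fin show "c \<le> real_of_ereal (opt_value S h)"
    by (cases "opt_value S h") auto
qed

section \<open>Blocks, neighbourhoods and local null spaces\<close>

lemma part_nth [simp]: "part D i x $ s = (if owner D s = i then x $ s else 0)"
  by (simp add: part_def)

lemma linear_part: "linear (part D i)"
  by (rule linearI) (auto simp: vec_eq_iff)

lemmas part_add = linear_add[OF linear_part]
  and part_scaleR = linear_scale[OF linear_part]
  and part_sum = linear_sum[OF linear_part]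

lemma subspace_blk: "subspace (blk D i)"
  by (auto simp: subspace_def blk_def)

lemma part_in_blk [simp]: "part D i x \<in> blk D i"
  by (simp add: blk_def)

lemma part_of_blk: "u \<in> blk D j \<Longrightarrow> part D i u = (if i = j then u else 0)"
  by (auto simp: blk_def vec_eq_iff)

lemma inner_part: "u \<in> blk D i \<Longrightarrow> part D i x \<bullet> u = x \<bullet> u"
  by (auto simp: inner_vec_def blk_def intro!: sum.cong)

lemma sum_part: "(\<Sum>i\<in>UNIV. part D i x) = x"
  by (simp add: vec_eq_iff if_distrib cong: if_cong)

lemma sum_norm_part: "(\<Sum>i\<in>UNIV. (norm (part D i x))\<^sup>2) = (norm x)\<^sup>2"
proof -
  have "(\<Sum>i\<in>UNIV. (norm (part D i x))\<^sup>2) = (\<Sum>i\<in>UNIV. part D i x \<bullet> x)"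
    by (simp add: power2_norm_eq_inner inner_part[OF part_in_blk] inner_commute)
  also have "\<dots> = (norm x)\<^sup>2"
    by (simp add: inner_sum_left[symmetric] sum_part power2_norm_eq_inner)
  finally show ?thesis .
qed

lemma part_sum_blocks:
  assumes "finite J" "\<And>j. j \<in> J \<Longrightarrow> p j \<in> blk D j"
  shows "part D i (\<Sum>j\<in>J. p j) = (if i \<in> J then p i else 0)"
proof -
  have "part D i (\<Sum>j\<in>J. p j) = (\<Sum>j\<in>J. if i = j then p j else 0)"
    unfolding part_sum using assms by (intro sum.cong) (simp_all add: part_of_blk)
  also have "\<dots> = (if i \<in> J then p i else 0)"
    using assms by simp
  finally show ?thesis .
qed

lemma coef_mult_sum_part: "(\<Sum>i\<in>UNIV. coef D *v part D i x) = coef D *v x"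
  by (metis linear_sum matrix_vector_mul_linear sum_part)

lemma part_eqI: "(\<And>i. part D i x = part D i y) \<Longrightarrow> x = y"
  by (metis sum.cong sum_part)

lemma cnbrs_sym: "j \<in> cnbrs D i \<longleftrightarrow> i \<in> cnbrs D j"
  by (auto simp: cnbrs_def nbrs_def insert_commute)

lemma cnbrs_self: "i \<in> cnbrs D i"
  by (simp add: cnbrs_def)

lemma card_cnbrs_pos: "0 < card (cnbrs D i)"
  using cnbrs_self[of i D] by (auto simp: card_gt_0_iff)

lemma step_weight_pos: "0 < step_weight D i"
proof -
  have "card (cnbrs D i) \<le> (MAX l\<in>cnbrs D i. card (cnbrs D l))"
    by (intro Max_ge) (auto intro: cnbrs_self)
  then show ?thesis
    using card_cnbrs_pos[of D i] by (simp add: step_weight_def)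
qed

text \<open>
  Every neighbour \<open>j\<close> of \<open>i\<close> takes its maximum over a set of nodes that contains \<open>i\<close>, so its weight
  is at most the reciprocal of the number of terms.
\<close>

lemma sum_step_weight_le_1: "(\<Sum>j\<in>cnbrs D i. step_weight D j) \<le> 1"
proof -
  have "step_weight D j \<le> 1 / card (cnbrs D i)" if "j \<in> cnbrs D i" for j
  proof -
    have "card (cnbrs D i) \<le> (MAX l\<in>cnbrs D j. card (cnbrs D l))"
      using that by (intro Max_ge) (auto simp: cnbrs_sym[of j])
    then show ?thesis
      unfolding step_weight_def using card_cnbrs_pos[of D i] by (intro divide_left_mono) auto
  qed
  then have "(\<Sum>j\<in>cnbrs D i. step_weight D j) \<le> of_nat (card (cnbrs D i)) * (1 / card (cnbrs D i))"
    by (rule sum_bounded_above)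
  then show ?thesis
    using card_cnbrs_pos[of D i] by (auto split: if_splits)
qed

lemma coef_mult_local_null:
  assumes "u \<in> local_null D i"
  shows "coef D *v u = 0"
proof -
  have "(\<Sum>j\<in>UNIV. coef D *v part D j u) = (\<Sum>j\<in>cnbrs D i. coef D *v part D j u)"
    using assms by (intro sum.mono_neutral_right) (auto simp: local_null_def)
  then show ?thesis
    using assms by (simp add: local_null_def coef_mult_sum_part)
qed

lemma subspace_local_null: "subspace (local_null D i)"
proof -
  have "part D j 0 = 0" for j
    using linear_0[OF linear_part] .
  then show ?thesis
    by (auto simp: subspace_def local_null_def part_add part_scaleR matrix_vector_right_distrib
        matrix_vector_mult_scaleR sum.distrib scaleR_sum_right[symmetric])
qed

lemma weighted_projections_weight_matrix:
  assumes "reachability D"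
  shows "weighted_projections (local_null D) (step_weight D) {u. coef D *v u = 0} (weight_matrix D)"
  using assms by unfold_locales
    (auto simp: subspace_local_null step_weight_pos reachability_def weight_matrix_def)

section \<open>The gradient of the barrier objective\<close>

definition barrier_grad ::
    "('N::finite, 'm::finite, 'v::finite) problem \<Rightarrow> 'v \<Rightarrow> real^'N \<Rightarrow> real^'N" where
  "barrier_grad D i u =
     (\<Sum>j=1..nineq D i. (1 / (ineq D i j u)\<^sup>2) *\<^sub>R grad_on (blk D i) (ineq D i j) u)"

definition block_grad ::
    "('N::finite, 'm::finite, 'v::finite) problem \<Rightarrow> real \<Rightarrow> 'v \<Rightarrow> real^'N \<Rightarrow> real^'N" where
  "block_grad D \<rho> i u = grad_on (blk D i) (obj D i) u + \<rho> *\<^sub>R barrier_grad D i u"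

definition block_model ::
    "('N::finite, 'm::finite, 'v::finite) problem \<Rightarrow> ('v \<Rightarrow> real) \<Rightarrow> real \<Rightarrow> 'v \<Rightarrow> real^'N \<Rightarrow> real^'N \<Rightarrow> real"
  where "block_model D L \<rho> i y u = quad_model D L i y u + \<rho> * barrier D i u"

lemma block_model_self: "block_model D L \<rho> i y y = obj D i y + \<rho> * barrier D i y"
  by (simp add: block_model_def quad_model_def)

lemma barrier_obj_blockwise:
  "barrier_obj D \<rho> x = (\<Sum>i\<in>UNIV. obj D i (part D i x) + \<rho> * barrier D i (part D i x))"
  by (simp add: barrier_obj_def total_obj_def total_barrier_def sum.distrib sum_distrib_left)

lemma Xint_subset_Xset: "Xint D i \<subseteq> Xset D i"
  by (auto simp: Xint_def Xset_def intro: less_imp_le)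

lemma feas_BP_subset_feas_P: "feas_BP D \<subseteq> feas_P D"
  using Xint_subset_Xset by (fastforce simp: feas_BP_def feas_P_def coef_mult_sum_part)

lemma nineq_le_Max: "nineq D i \<le> (MAX i. nineq D i)"
  by simp

locale barrier_problem =
  fixes D :: "('N::finite, 'm::finite, 'v::finite) problem"
    and L :: "'v \<Rightarrow> real" and \<beta> \<beta>\<^sub>1 \<rho> :: real
  assumes regular: "regular_problem D L \<beta> \<beta>\<^sub>1" and \<rho>_pos: "0 < \<rho>"
begin

abbreviation F where "F \<equiv> barrier_obj D \<rho>"
abbreviation fstar where "fstar \<equiv> real_of_ereal (opt_P D)"
abbreviation Lmax where "Lmax \<equiv> max_smoothness L"

lemma L_pos: "0 < L i" and obj_smooth: "smooth_fun_on (blk D i) (L i) (obj D i)"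
  using regular by (auto simp: regular_problem_def)

lemma
  assumes "j \<in> {1..nineq D i}"
  shows ineq_convex: "convex_on (blk D i) (ineq D i j)"
    and ineq_smooth: "smooth_fun_on (blk D i) \<beta> (ineq D i j)"
    and ineq_lipschitz: "\<beta>\<^sub>1-lipschitz_on (Xset D i) (ineq D i j)"
  using regular assms by (auto simp: regular_problem_def)

lemma L_le_Lmax: "L i \<le> Lmax"
  by (simp add: max_smoothness_def)

lemma Lmax_pos: "0 < Lmax"
  using L_pos[of undefined] L_le_Lmax[of undefined] by linarith

lemma obj_has_derivative:
  assumes "u \<in> blk D i"
  shows "(obj D i has_derivative (\<lambda>h. h \<bullet> grad_on (blk D i) (obj D i) u)) (at u within blk D i)"
  using assms obj_smooth[of i] by (intro grad_on_derivative subspace_blk) (auto simp: smooth_fun_on_def)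

lemma ineq_has_derivative:
  assumes "u \<in> blk D i" "j \<in> {1..nineq D i}"
  shows "(ineq D i j has_derivative (\<lambda>h. h \<bullet> grad_on (blk D i) (ineq D i j) u)) (at u within blk D i)"
  using assms ineq_smooth[OF assms(2)]
  by (intro grad_on_derivative subspace_blk) (auto simp: smooth_fun_on_def)

lemma convex_Xint: "convex (Xint D i)"
proof (rule convexI)
  fix u v and a b :: real
  assume uv: "u \<in> Xint D i" "v \<in> Xint D i" and ab: "0 \<le> a" "0 \<le> b" "a + b = 1"
  have "ineq D i j (a *\<^sub>R u + b *\<^sub>R v) < 0" if j: "j \<in> {1..nineq D i}" for j
  proof -
    have "ineq D i j (a *\<^sub>R u + b *\<^sub>R v) \<le> a * ineq D i j u + b * ineq D i j v"
      using ineq_convex[OF j] uv ab by (auto simp: convex_on_def Xint_def)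
    also have "\<dots> < 0"
    proof (cases "a = 0")
      case False
      then show ?thesis
        using uv ab j by (intro add_neg_nonpos mult_pos_neg mult_nonneg_nonpos) (auto simp: Xint_def intro: less_imp_le)
    qed (use uv ab j in \<open>auto simp: Xint_def\<close>)
    finally show ?thesis .
  qed
  moreover have "a *\<^sub>R u + b *\<^sub>R v \<in> blk D i"
    using uv subspace_blk[of D i] by (auto simp: Xint_def intro: subspace_add subspace_scale)
  ultimately show "a *\<^sub>R u + b *\<^sub>R v \<in> Xint D i"
    by (simp add: Xint_def)
qed

lemma convex_on_barrier: "convex_on (Xint D i) (barrier D i)"
proof -
  have "convex_on (Xint D i) (\<lambda>u. - 1 / ineq D i j u)" if "j \<in> {1..nineq D i}" for j
    by (rule convex_on_neg_reciprocal[OF convex_on_subset[OF ineq_convex[OF that] _ convex_Xint]])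
      (use that in \<open>auto simp: Xint_def\<close>)
  then have "convex_on (Xint D i) (\<lambda>u. \<Sum>j=1..nineq D i. - 1 / ineq D i j u)"
    using convex_Xint by (intro convex_on_sum_functions) auto
  then show ?thesis
    by (simp add: barrier_def[abs_def] sum_negf)
qed

lemma barrier_nonneg: "u \<in> Xint D i \<Longrightarrow> 0 \<le> barrier D i u"
  by (auto simp: barrier_def Xint_def sum_negf[symmetric] intro!: sum_nonneg)

lemma barrier_has_derivative:
  assumes u: "u \<in> Xint D i"
  shows "(barrier D i has_derivative (\<lambda>h. h \<bullet> barrier_grad D i u)) (at u within blk D i)"
proof -
  have "((\<lambda>u. \<Sum>j=1..nineq D i. 1 / ineq D i j u) has_derivative
      (\<lambda>h. \<Sum>j=1..nineq D i. - (h \<bullet> grad_on (blk D i) (ineq D i j) u) / (ineq D i j u)\<^sup>2))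
      (at u within blk D i)"
  proof (rule has_derivative_sum)
    fix j assume j: "j \<in> {1..nineq D i}"
    have "ineq D i j u < 0" and blk: "u \<in> blk D i"
      using u j unfolding Xint_def by blast+
    then have "ineq D i j u \<noteq> 0"
      by simp
    from has_derivative_divide'[OF has_derivative_const[of 1] ineq_has_derivative[OF blk j] this]
    show "((\<lambda>u. 1 / ineq D i j u) has_derivative
        (\<lambda>h. - (h \<bullet> grad_on (blk D i) (ineq D i j) u) / (ineq D i j u)\<^sup>2)) (at u within blk D i)"
      by (rule has_derivative_eq_rhs) (simp add: power2_eq_square)
  qed
  from has_derivative_minus[OF this] show ?thesis
    unfolding barrier_def[abs_def]
    by (rule has_derivative_eq_rhs) (simp add: barrier_grad_def inner_sum_right sum_negf)
qed

lemma block_has_derivative: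
  assumes u: "u \<in> Xint D i"
  shows "((\<lambda>u. obj D i u + \<rho> * barrier D i u) has_derivative (\<lambda>h. h \<bullet> block_grad D \<rho> i u))
    (at u within blk D i)"
proof -
  have "u \<in> blk D i"
    using u by (simp add: Xint_def)
  show ?thesis
    by (rule has_derivative_eq_rhs[OF has_derivative_add[OF obj_has_derivative[OF \<open>u \<in> blk D i\<close>]
          has_derivative_mult_right[OF barrier_has_derivative[OF u]]]])
      (simp add: block_grad_def inner_add_right)
qed

lemma inner_grad_barrier_obj:
  assumes x: "\<And>i. part D i x \<in> Xint D i"
  shows "grad F x \<bullet> d = (\<Sum>i\<in>UNIV. part D i d \<bullet> block_grad D \<rho> i (part D i x))"
proof -
  have "((\<lambda>x. obj D i (part D i x) + \<rho> * barrier D i (part D i x)) has_derivative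
      (\<lambda>d. part D i d \<bullet> block_grad D \<rho> i (part D i x))) (at x)" for i
  proof (rule has_derivative_in_compose[where f = "part D i"])
    show "(part D i has_derivative part D i) (at x)"
      by (rule linear_imp_has_derivative[OF linear_part])
    show "((\<lambda>u. obj D i u + \<rho> * barrier D i u) has_derivative (\<lambda>h. h \<bullet> block_grad D \<rho> i (part D i x)))
        (at (part D i x) within range (part D i))"
      by (rule has_derivative_subset[OF block_has_derivative[OF x]]) auto
  qed
  then have F: "(F has_derivative (\<lambda>d. \<Sum>i\<in>UNIV. part D i d \<bullet> block_grad D \<rho> i (part D i x))) (at x)"
    unfolding barrier_obj_blockwise[abs_def] by (rule has_derivative_sum)
  then have "F differentiable (at x)"
    by (auto simp: differentiable_def)
  then have "(F has_derivative (\<lambda>d. d \<bullet> grad F x)) (at x)"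
    by (intro grad_on_derivative) auto
  from has_derivative_unique[OF this F] show ?thesis
    by (simp add: inner_commute fun_eq_iff)
qed

section \<open>The local model along a line\<close>

lemma obj_le_quad_model:
  assumes "y \<in> blk D i" "u \<in> blk D i"
  shows "obj D i u \<le> quad_model D L i y u"
  unfolding quad_model_def using assms by (intro smooth_fun_on_upper_bound subspace_blk obj_smooth)

lemma barrier_obj_le_model:
  "F z \<le> (\<Sum>i\<in>UNIV. block_model D L \<rho> i (part D i x) (part D i z))"
  unfolding barrier_obj_blockwise block_model_def
  by (intro sum_mono add_right_mono obj_le_quad_model part_in_blk)

lemma ineq_along_line:
  assumes "y \<in> blk D i" "d \<in> blk D i" "j \<in> {1..nineq D i}"
  shows "((\<lambda>a. ineq D i j (y + a *\<^sub>R d)) has_real_derivative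
    d \<bullet> grad_on (blk D i) (ineq D i j) (y + a *\<^sub>R d)) (at a)"
  using assms subspace_blk[of D i]
  by (intro has_real_derivative_along_line[where S = "blk D i"] ineq_has_derivative)
    (auto intro: subspace_add subspace_scale)

text \<open>
  The Lipschitz bound on the constraint set bounds directional derivatives at strictly feasible
  points, since all nearby points of the line are feasible.
\<close>

lemma ineq_directional_derivative_bound:
  assumes y: "y \<in> Xint D i" and d: "d \<in> blk D i" and j: "j \<in> {1..nineq D i}"
  shows "\<bar>d \<bullet> grad_on (blk D i) (ineq D i j) y\<bar> \<le> \<beta>\<^sub>1 * norm d"
proof -
  have yb: "y \<in> blk D i"
    using y by (simp add: Xint_def)
  have "\<forall>\<^sub>F a in at 0. ineq D i l (y + a *\<^sub>R d) < 0" if l: "l \<in> {1..nineq D i}" for l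
  proof (rule order_tendstoD(2))
    show "((\<lambda>a. ineq D i l (y + a *\<^sub>R d)) \<longlongrightarrow> ineq D i l y) (at 0)"
      using DERIV_isCont[OF ineq_along_line[OF yb d l, of 0]] by (simp add: isCont_def)
    show "ineq D i l y < 0"
      using y l by (simp add: Xint_def)
  qed
  then have "\<forall>\<^sub>F a in at 0. \<forall>l\<in>{1..nineq D i}. ineq D i l (y + a *\<^sub>R d) < 0"
    by (intro eventually_ball_finite) auto
  then have "\<forall>\<^sub>F a in at 0. \<bar>ineq D i j (y + a *\<^sub>R d) - ineq D i j (y + 0 *\<^sub>R d)\<bar> \<le> \<beta>\<^sub>1 * norm d * \<bar>a - 0\<bar>"
  proof eventually_elim
    case (elim a)
    have "y + a *\<^sub>R d \<in> Xset D i"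
      using elim yb d subspace_blk[of D i]
      by (auto simp: Xset_def intro!: less_imp_le subspace_add subspace_scale)
    then have "dist (ineq D i j (y + a *\<^sub>R d)) (ineq D i j y) \<le> \<beta>\<^sub>1 * dist (y + a *\<^sub>R d) y"
      using y Xint_subset_Xset by (intro lipschitz_onD[OF ineq_lipschitz[OF j]]) auto
    then show ?case
      by (simp add: dist_norm mult_ac)
  qed
  from abs_derivative_le_local_slope[OF ineq_along_line[OF yb d j] this] show ?thesis
    by simp
qed

lemma barrier_derivative_lipschitz:
  assumes y: "y \<in> blk D i" and d: "d \<in> blk D i" and "0 \<le> a" "0 < \<tau>"
    and g: "\<And>j. j \<in> {1..nineq D i} \<Longrightarrow> ineq D i j y \<le> - 1 / \<tau>"
      "\<And>j. j \<in> {1..nineq D i} \<Longrightarrow> ineq D i j (y + a *\<^sub>R d) \<le> - 1 / \<tau>"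
  shows "d \<bullet> barrier_grad D i (y + a *\<^sub>R d) - d \<bullet> barrier_grad D i y
    \<le> real (nineq D i) * ((\<beta> * \<tau>\<^sup>2 + 2 * \<beta>\<^sub>1\<^sup>2 * \<tau> ^ 3) * (norm d)\<^sup>2 * a)"
proof -
  let ?g = "\<lambda>j. ineq D i j" and ?G = "\<lambda>j. grad_on (blk D i) (ineq D i j)" and ?z = "y + a *\<^sub>R d"
  let ?q = "\<lambda>j. d \<bullet> ?G j ?z / (?g j ?z)\<^sup>2 - d \<bullet> ?G j y / (?g j y)\<^sup>2"
  have z: "?z \<in> blk D i"
    using y d subspace_blk[of D i] by (auto intro: subspace_add subspace_scale)
  have "- 1 / \<tau> < 0"
    using \<open>0 < \<tau>\<close> by simp
  then have int: "y \<in> Xint D i" "?z \<in> Xint D i"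
    using y z le_less_trans[OF g(1)] le_less_trans[OF g(2)] by (auto simp: Xint_def)
  have "?q j \<le> (\<beta> * \<tau>\<^sup>2 + 2 * \<beta>\<^sub>1\<^sup>2 * \<tau> ^ 3) * (norm d)\<^sup>2 * a" if j: "j \<in> {1..nineq D i}" for j
  proof -
    have "dist (?g j ?z) (?g j y) \<le> \<beta>\<^sub>1 * dist ?z y"
      using int Xint_subset_Xset by (intro lipschitz_onD[OF ineq_lipschitz[OF j]]) auto
    then have 1: "\<bar>?g j ?z - ?g j y\<bar> \<le> \<beta>\<^sub>1 * norm d * a"
      using \<open>0 \<le> a\<close> by (simp add: dist_norm mult_ac)
    have "dist (?G j ?z) (?G j y) \<le> \<beta> * dist ?z y"
      using ineq_smooth[OF j] y z by (auto simp: smooth_fun_on_def dest: lipschitz_onD)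
    then have G: "norm (?G j ?z - ?G j y) \<le> \<beta> * (a * norm d)"
      using \<open>0 \<le> a\<close> by (simp add: dist_norm)
    have "\<bar>d \<bullet> (?G j ?z - ?G j y)\<bar> \<le> norm d * norm (?G j ?z - ?G j y)"
      by (rule Cauchy_Schwarz_ineq2)
    also have "\<dots> \<le> norm d * (\<beta> * (a * norm d))"
      using G by (rule mult_left_mono) simp
    finally have 2: "\<bar>d \<bullet> ?G j ?z - d \<bullet> ?G j y\<bar> \<le> \<beta> * (norm d)\<^sup>2 * a"
      by (simp add: inner_diff_right power2_eq_square mult_ac)
    have 3: "\<bar>d \<bullet> ?G j y\<bar> \<le> \<beta>\<^sub>1 * norm d"
      using int d j by (intro ineq_directional_derivative_bound)
    show ?thesis
      using reciprocal_derivative_lipschitz[OF \<open>0 < \<tau>\<close> g(1)[OF j] g(2)[OF j] 1 2 3 \<open>0 \<le> a\<close>] by linarith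
  qed
  then have "(\<Sum>j=1..nineq D i. ?q j)
      \<le> of_nat (card {1..nineq D i}) * ((\<beta> * \<tau>\<^sup>2 + 2 * \<beta>\<^sub>1\<^sup>2 * \<tau> ^ 3) * (norm d)\<^sup>2 * a)"
    by (rule sum_bounded_above)
  then show ?thesis
    by (simp add: barrier_grad_def inner_sum_right sum_subtractf)
qed

lemma \<beta>_nonneg_if_constrained:
  assumes "nineq D i \<noteq> 0"
  shows "0 \<le> \<beta>"
  using ineq_smooth[of 1 i] assms by (auto simp: smooth_fun_on_def dest: lipschitz_on_nonneg)

lemma constrained_block_exists:
  assumes "(MAX i. nineq D i) \<noteq> 0"
  obtains i where "nineq D i \<noteq> 0"
proof -
  have "(MAX i. nineq D i) \<in> range (nineq D)"
    by (rule Max_in) auto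
  then show thesis
    using assms that by (metis rangeE)
qed

lemma nineq_mult_le_Max:
  assumes "0 < \<tau>"
  shows "real (nineq D i) * (\<beta> * \<tau>\<^sup>2 + 2 * \<beta>\<^sub>1\<^sup>2 * \<tau> ^ 3)
    \<le> real (MAX i. nineq D i) * (\<beta> * \<tau>\<^sup>2 + 2 * \<beta>\<^sub>1\<^sup>2 * \<tau> ^ 3)"
proof (cases "(MAX i. nineq D i) = 0")
  case True
  then have "nineq D i = 0"
    using nineq_le_Max[of D i] by simp
  with True show ?thesis
    by simp
next
  case False
  then have "0 \<le> \<beta>"
    using constrained_block_exists \<beta>_nonneg_if_constrained by metis
  then show ?thesis
    using assms nineq_le_Max[of D i] by (intro mult_right_mono) auto
qed

definition model_smoothness where
  "model_smoothness \<tau> = Lmax + \<rho> * (real (MAX i. nineq D i) * (\<beta> * \<tau>\<^sup>2 + 2 * \<beta>\<^sub>1\<^sup>2 * \<tau> ^ 3))"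

text \<open>
  While all constraints stay below \<open>- 1 / \<tau>\<close>, the slope of the total model along \<open>d\<close> grows at most at
  the rate \<open>model_smoothness \<tau> * \<parallel>d\<parallel>\<^sup>2\<close>. The blocks are orthogonal, so the blockwise bounds add up to
  one in terms of the norm of \<open>d\<close> without a factor for the number of blocks.
\<close>

lemma model_along_line:
  assumes "0 \<le> s" "0 < \<tau>"
    and g: "\<And>a i j. 0 \<le> a \<Longrightarrow> a \<le> s \<Longrightarrow> j \<in> {1..nineq D i} \<Longrightarrow>
      ineq D i j (part D i x + a *\<^sub>R part D i d) \<le> - 1 / \<tau>"
  shows "(\<Sum>i\<in>UNIV. block_model D L \<rho> i (part D i x) (part D i x + s *\<^sub>R part D i d))
    \<le> F x + grad F x \<bullet> d * s + model_smoothness \<tau> * (norm d)\<^sup>2 / 2 * s\<^sup>2"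
proof -
  let ?y = "\<lambda>i. part D i x" and ?d = "\<lambda>i. part D i d"
  define \<phi> where "\<phi> a = (\<Sum>i\<in>UNIV. block_model D L \<rho> i (?y i) (?y i + a *\<^sub>R ?d i))" for a
  define \<phi>' where "\<phi>' a = (\<Sum>i\<in>UNIV. ?d i \<bullet> grad_on (blk D i) (obj D i) (?y i) + L i * (norm (?d i))\<^sup>2 * a
      + \<rho> * (?d i \<bullet> barrier_grad D i (?y i + a *\<^sub>R ?d i)))" for a
  have blk: "?y i + a *\<^sub>R ?d i \<in> blk D i" for a i
    by (metis part_add part_scaleR part_in_blk)
  have neg: "- 1 / \<tau> < 0"
    using \<open>0 < \<tau>\<close> by simp
  have int: "?y i + a *\<^sub>R ?d i \<in> Xint D i" if "0 \<le> a" "a \<le> s" for a i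
    using blk le_less_trans[OF g[OF that] neg] by (auto simp: Xint_def)
  have x: "?y i \<in> Xint D i" for i
    using int[of 0 i] \<open>0 \<le> s\<close> by simp
  have "\<phi> s \<le> \<phi> 0 + \<phi>' 0 * s + (model_smoothness \<tau> * (norm d)\<^sup>2) / 2 * s\<^sup>2"
  proof (rule quadratic_upper_bound[OF \<open>0 \<le> s\<close>])
    fix a assume a: "0 \<le> a" "a \<le> s"
    have quad: "quad_model D L i (?y i) (?y i + a *\<^sub>R ?d i) = obj D i (?y i)
        + (?d i \<bullet> grad_on (blk D i) (obj D i) (?y i)) * a + L i / 2 * (norm (?d i))\<^sup>2 * a\<^sup>2" for i a
      by (simp add: quad_model_def inner_commute power_mult_distrib)
    have "((\<lambda>a. barrier D i (?y i + a *\<^sub>R ?d i)) has_real_derivative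
        ?d i \<bullet> barrier_grad D i (?y i + a *\<^sub>R ?d i)) (at a)" for i
      by (rule has_real_derivative_along_line[OF barrier_has_derivative[OF int[OF a]] subspace_blk]) auto
    then show "(\<phi> has_real_derivative \<phi>' a) (at a)"
      unfolding \<phi>_def[abs_def] \<phi>'_def block_model_def quad
      by (auto intro!: derivative_eq_intros sum.cong)
    have "\<phi>' a - \<phi>' 0 = (\<Sum>i\<in>UNIV. L i * (norm (?d i))\<^sup>2 * a
        + \<rho> * (?d i \<bullet> barrier_grad D i (?y i + a *\<^sub>R ?d i) - ?d i \<bullet> barrier_grad D i (?y i)))"
      unfolding \<phi>'_def sum_subtractf[symmetric] by (intro sum.cong) (simp_all add: algebra_simps)
    also have "\<dots> \<le> (\<Sum>i\<in>UNIV. model_smoothness \<tau> * a * (norm (?d i))\<^sup>2)"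
    proof (rule sum_mono)
      fix i
      let ?K = "\<beta> * \<tau>\<^sup>2 + 2 * \<beta>\<^sub>1\<^sup>2 * \<tau> ^ 3"
      have "?d i \<bullet> barrier_grad D i (?y i + a *\<^sub>R ?d i) - ?d i \<bullet> barrier_grad D i (?y i)
          \<le> real (nineq D i) * (?K * (norm (?d i))\<^sup>2 * a)"
        using g[OF a] g[of 0] \<open>0 \<le> s\<close> a \<open>0 < \<tau>\<close> by (intro barrier_derivative_lipschitz) auto
      also have "\<dots> = (real (nineq D i) * ?K) * ((norm (?d i))\<^sup>2 * a)"
        by (simp add: mult_ac)
      also have "\<dots> \<le> (real (MAX i. nineq D i) * ?K) * ((norm (?d i))\<^sup>2 * a)"
        using a by (intro mult_right_mono[OF nineq_mult_le_Max[OF \<open>0 < \<tau>\<close>]]) auto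
      finally have "\<rho> * (?d i \<bullet> barrier_grad D i (?y i + a *\<^sub>R ?d i) - ?d i \<bullet> barrier_grad D i (?y i))
          \<le> \<rho> * ((real (MAX i. nineq D i) * ?K) * ((norm (?d i))\<^sup>2 * a))"
        using \<rho>_pos by (intro mult_left_mono) auto
      moreover have "L i * ((norm (?d i))\<^sup>2 * a) \<le> Lmax * ((norm (?d i))\<^sup>2 * a)"
        using a L_le_Lmax by (intro mult_right_mono) auto
      ultimately show "L i * (norm (?d i))\<^sup>2 * a
          + \<rho> * (?d i \<bullet> barrier_grad D i (?y i + a *\<^sub>R ?d i) - ?d i \<bullet> barrier_grad D i (?y i))
          \<le> model_smoothness \<tau> * a * (norm (?d i))\<^sup>2"
        unfolding model_smoothness_def distrib_right by (simp add: mult_ac)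
    qed
    also have "\<dots> = model_smoothness \<tau> * (norm d)\<^sup>2 * a"
      by (simp add: sum_distrib_left[symmetric] sum_norm_part)
    finally show "\<phi>' a - \<phi>' 0 \<le> model_smoothness \<tau> * (norm d)\<^sup>2 * a" .
  qed
  moreover have "\<phi> 0 = F x"
    by (simp add: \<phi>_def block_model_self barrier_obj_blockwise)
  moreover have "\<phi>' 0 = grad F x \<bullet> d"
    unfolding inner_grad_barrier_obj[OF x] by (simp add: \<phi>'_def block_grad_def inner_add_right)
  ultimately show ?thesis
    by (simp add: \<phi>_def)
qed

end

section \<open>Staying in the initial sublevel set\<close>

locale barrier_method = barrier_problem D L \<beta> \<beta>\<^sub>1 \<rho>
  for D :: "('N::finite, 'm::finite, 'v::finite) problem"
    and L :: "'v \<Rightarrow> real" and \<beta> \<beta>\<^sub>1 \<rho> :: real +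
  fixes x\<^sub>0 :: "real^'N"
  assumes start: "x\<^sub>0 \<in> feas_BP D"
begin

text \<open>The constant \<open>L + \<rho> L\<^sub>B\<close>. Its reciprocal is the length of the comparison step.\<close>

definition M :: real where
  "M = Lmax + \<rho> * barrier_smoothness D \<rho> \<beta> \<beta>\<^sub>1 x\<^sub>0"

definition excess :: real where
  "excess = (F x\<^sub>0 - fstar) / \<rho>"

lemma total_barrier_nonneg: "y \<in> feas_BP D \<Longrightarrow> 0 \<le> total_barrier D y"
  by (auto simp: total_barrier_def feas_BP_def intro!: sum_nonneg barrier_nonneg)

lemma fstar_le_total_obj: "y \<in> feas_BP D \<Longrightarrow> fstar \<le> total_obj D y"
  unfolding opt_P_def using regular feas_BP_subset_feas_P
  by (intro opt_value_le) (auto simp: regular_problem_def opt_P_def)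

lemma fstar_le_F: "y \<in> feas_BP D \<Longrightarrow> fstar \<le> F y"
  using fstar_le_total_obj[of y] mult_nonneg_nonneg[OF less_imp_le[OF \<rho>_pos] total_barrier_nonneg[of y]]
  by (simp add: barrier_obj_def)

text \<open>
  On the sublevel set the whole barrier is at most the excess, and every reciprocal is a part of the
  barrier.
\<close>

lemma
  assumes y: "y \<in> feas_BP D" "F y \<le> F x\<^sub>0" and j: "j \<in> {1..nineq D i}"
  shows excess_pos: "0 < excess"
    and ineq_le_on_sublevel: "ineq D i j (part D i y) \<le> - 1 / excess"
proof -
  have int: "part D i y \<in> Xint D i" for i
    using y by (simp add: feas_BP_def)
  have neg: "ineq D l k (part D l y) < 0" if "k \<in> {1..nineq D l}" for l k
    using int[of l] that unfolding Xint_def by blast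
  have "- 1 / ineq D i j (part D i y) \<le> (\<Sum>j=1..nineq D i. - 1 / ineq D i j (part D i y))"
    using j neg by (intro member_le_sum[of j]) (auto intro: less_imp_le)
  also have "\<dots> = barrier D i (part D i y)"
    by (simp add: barrier_def sum_negf)
  also have "\<dots> \<le> total_barrier D y"
    unfolding total_barrier_def
    using int by (intro member_le_sum[of i UNIV "\<lambda>i. barrier D i (part D i y)"]) (auto intro: barrier_nonneg)
  also have "\<dots> \<le> excess"
  proof -
    have "\<rho> * total_barrier D y \<le> F x\<^sub>0 - fstar"
      using y fstar_le_total_obj[of y] by (simp add: barrier_obj_def)
    then show ?thesis
      using \<rho>_pos by (simp add: excess_def pos_le_divide_eq mult.commute)
  qed
  finally have le: "- 1 / ineq D i j (part D i y) \<le> excess" .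
  moreover have "0 < - 1 / ineq D i j (part D i y)"
    using neg[OF j] by simp
  ultimately show "0 < excess"
    by linarith
  then show "ineq D i j (part D i y) \<le> - 1 / excess"
    using le neg[OF j] by (simp add: field_simps)
qed

text \<open>
  The constant of the barrier is twice the bound obtained from the excess itself. This leaves room
  for reciprocals up to \<open>5/4\<close> of the excess, because \<open>(5/4)\<^sup>3 < 2\<close>. The excess can
  vanish only if there are no constraints, and then any positive threshold is respected.
\<close>

definition relaxed_excess :: real where
  "relaxed_excess = (if 0 < excess then 5 / 4 * excess else 1)"

lemma relaxed_excess_pos: "0 < relaxed_excess"
  by (simp add: relaxed_excess_def)

lemma excess_pos_if_constrained:
  assumes "nineq D i \<noteq> 0"
  shows "0 < excess"
  using excess_pos[OF start, of 1 i] assms by simp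

lemma model_smoothness_le_M: "model_smoothness relaxed_excess \<le> M"
proof -
  let ?q = "MAX i. nineq D i"
  have "real ?q * (\<beta> * relaxed_excess\<^sup>2 + 2 * \<beta>\<^sub>1\<^sup>2 * relaxed_excess ^ 3)
      \<le> real ?q * (4 * \<beta>\<^sub>1\<^sup>2 * excess ^ 3 + 2 * \<beta> * excess\<^sup>2)"
  proof (cases "?q = 0")
    case False
    then obtain i where i: "nineq D i \<noteq> 0"
      by (rule constrained_block_exists)
    then have "0 \<le> \<beta>"
      by (rule \<beta>_nonneg_if_constrained)
    have exc: "0 < excess"
      using i by (rule excess_pos_if_constrained)
    have "\<beta> * relaxed_excess\<^sup>2 \<le> 2 * \<beta> * excess\<^sup>2"
      using exc \<open>0 \<le> \<beta>\<close> by (simp add: relaxed_excess_def power2_eq_square mult_left_mono)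
    moreover have "2 * \<beta>\<^sub>1\<^sup>2 * relaxed_excess ^ 3 \<le> 4 * \<beta>\<^sub>1\<^sup>2 * excess ^ 3"
    proof -
      have "relaxed_excess ^ 3 = (125 / 64) * excess ^ 3"
        using exc by (simp add: relaxed_excess_def power3_eq_cube)
      also have "\<dots> \<le> 2 * excess ^ 3"
        using exc by simp
      finally have "(2 * \<beta>\<^sub>1\<^sup>2) * relaxed_excess ^ 3 \<le> (2 * \<beta>\<^sub>1\<^sup>2) * (2 * excess ^ 3)"
        by (rule mult_left_mono) simp
      then show ?thesis
        by simp
    qed
    ultimately show ?thesis
      by (intro mult_left_mono) auto
  qed simp
  then show ?thesis
    using \<rho>_pos unfolding model_smoothness_def M_def barrier_smoothness_def excess_def Let_def
    by (simp add: mult.commute)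
qed

lemma model_smoothness_relaxed_excess_pos: "0 < model_smoothness relaxed_excess"
proof -
  have "0 \<le> real (MAX i. nineq D i) * (\<beta> * relaxed_excess\<^sup>2 + 2 * \<beta>\<^sub>1\<^sup>2 * relaxed_excess ^ 3)"
  proof (cases "(MAX i. nineq D i) = 0")
    case False
    then have "0 \<le> \<beta>"
      using constrained_block_exists \<beta>_nonneg_if_constrained by metis
    then show ?thesis
      using relaxed_excess_pos by simp
  qed simp
  then show ?thesis
    using Lmax_pos \<rho>_pos unfolding model_smoothness_def by (intro add_pos_nonneg) auto
qed

lemma M_pos: "0 < M"
  using model_smoothness_le_M model_smoothness_relaxed_excess_pos by linarith

text \<open>
  Suppose that some constraint reaches the relaxed threshold on the step, and let \<open>a\<close> be the first
  time at which this happens. Up to \<open>a\<close> the model has curvature at most \<open>M\<close>, so the objective has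
  not increased at \<open>a\<close>. But then all constraints satisfy the strict, unrelaxed threshold at \<open>a\<close>, a
  contradiction. Hence the quadratic bound is valid for the whole step.
\<close>

lemma model_decrease:
  assumes x: "x \<in> feas_BP D" "F x \<le> F x\<^sub>0"
    and d: "coef D *v d = 0" "grad F x \<bullet> d = - (norm d)\<^sup>2"
  shows "x + (1 / M) *\<^sub>R d \<in> feas_BP D"
    and "(\<Sum>i\<in>UNIV. block_model D L \<rho> i (part D i x) (part D i x + (1 / M) *\<^sub>R part D i d))
      \<le> F x - (norm d)\<^sup>2 / (2 * M)"
proof -
  let ?\<tau> = relaxed_excess
  define g where "g i j a = ineq D i j (part D i x + a *\<^sub>R part D i d)" for i j a
  define hit where "hit = (\<Union>i. \<Union>j\<in>{1..nineq D i}. {0..1 / M} \<inter> g i j -` {- 1 / ?\<tau>..})"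
  have cont: "isCont (g i j) a" if "j \<in> {1..nineq D i}" for i j a
    unfolding g_def[abs_def] using that by (intro DERIV_isCont[OF ineq_along_line]) auto
  have part_line: "part D i (x + a *\<^sub>R d) = part D i x + a *\<^sub>R part D i d" for i a
    by (simp add: part_add part_scaleR)
  have in_sublevel: "g i j a < - 1 / ?\<tau>"
    if "x + a *\<^sub>R d \<in> feas_BP D" "F (x + a *\<^sub>R d) \<le> F x\<^sub>0" "j \<in> {1..nineq D i}" for i j a
  proof -
    have "- 1 / excess < - 1 / ?\<tau>"
      using excess_pos[OF that] by (simp add: relaxed_excess_def field_simps)
    then show ?thesis
      using ineq_le_on_sublevel[OF that] by (simp add: g_def part_line)
  qed
  have feasible: "x + a *\<^sub>R d \<in> feas_BP D" if "\<And>i j. j \<in> {1..nineq D i} \<Longrightarrow> g i j a \<le> - 1 / ?\<tau>" for a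
  proof -
    have "- 1 / ?\<tau> < 0"
      using relaxed_excess_pos by simp
    then have "g i j a < 0" if "j \<in> {1..nineq D i}" for i j
      using \<open>\<And>i j. j \<in> {1..nineq D i} \<Longrightarrow> g i j a \<le> - 1 / ?\<tau>\<close>[OF that] by linarith
    moreover have "part D i x + a *\<^sub>R part D i d \<in> blk D i" for i
      by (metis part_line part_in_blk)
    ultimately show ?thesis
      using x d by (auto simp: feas_BP_def Xint_def part_line g_def matrix_vector_right_distrib
          matrix_vector_mult_scaleR)
  qed
  have model: "(\<Sum>i\<in>UNIV. block_model D L \<rho> i (part D i x) (part D i x + s *\<^sub>R part D i d))
      \<le> F x - (norm d)\<^sup>2 * s + M * (norm d)\<^sup>2 / 2 * s\<^sup>2"
    if s: "0 \<le> s" and le: "\<And>a i j. 0 \<le> a \<Longrightarrow> a \<le> s \<Longrightarrow> j \<in> {1..nineq D i} \<Longrightarrow> g i j a \<le> - 1 / ?\<tau>" for s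
  proof -
    have "(\<Sum>i\<in>UNIV. block_model D L \<rho> i (part D i x) (part D i x + s *\<^sub>R part D i d))
        \<le> F x + grad F x \<bullet> d * s + model_smoothness ?\<tau> * (norm d)\<^sup>2 / 2 * s\<^sup>2"
      using le by (intro model_along_line[OF s relaxed_excess_pos]) (simp add: g_def)
    also have "model_smoothness ?\<tau> * (norm d)\<^sup>2 / 2 * s\<^sup>2 \<le> M * (norm d)\<^sup>2 / 2 * s\<^sup>2"
      using model_smoothness_le_M by (intro mult_right_mono divide_right_mono) auto
    finally show ?thesis
      using d by simp
  qed
  have "hit = {}"
  proof (rule ccontr)
    assume "hit \<noteq> {}"
    define a where "a = Inf hit"
    have "closed hit"
      unfolding hit_def
      by (intro closed_UN closed_Int ballI continuous_closed_vimage cont) auto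
    moreover have bdd: "bdd_below hit"
      by (rule bdd_belowI[of _ 0]) (auto simp: hit_def)
    ultimately have "a \<in> hit"
      unfolding a_def using \<open>hit \<noteq> {}\<close> by (intro closed_contains_Inf)
    then obtain i j where j: "j \<in> {1..nineq D i}" and gij: "- 1 / ?\<tau> \<le> g i j a"
      and a: "0 \<le> a" "a \<le> 1 / M"
      by (auto simp: hit_def)
    have before: "g i j b < - 1 / ?\<tau>" if "0 \<le> b" "b < a" "j \<in> {1..nineq D i}" for i j b
    proof (rule ccontr)
      assume "\<not> g i j b < - 1 / ?\<tau>"
      then have "b \<in> hit"
        unfolding hit_def using that a by (auto simp: not_less intro!: exI[of _ i] bexI[of _ j])
      then have "a \<le> b"
        unfolding a_def using bdd by (rule cInf_lower)
      with that show False
        by simp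
    qed
    have "a \<noteq> 0"
      using in_sublevel[of 0 j i] x j gij by auto
    then have "0 < a"
      using a by simp
    have upto: "g i j b \<le> - 1 / ?\<tau>" if "0 \<le> b" "b \<le> a" "j \<in> {1..nineq D i}" for i j b
    proof (cases "b = a")
      case True
      have "(g i j \<longlongrightarrow> g i j a) (at_left a)"
        using cont[OF that(3), of a] by (simp add: isCont_def filterlim_at_split)
      moreover have "\<forall>\<^sub>F b in at_left a. g i j b \<le> - 1 / ?\<tau>"
        using eventually_at_left_real[OF \<open>0 < a\<close>]
        by eventually_elim (use before that in \<open>auto intro: less_imp_le\<close>)
      ultimately show ?thesis
        unfolding True by (rule tendsto_upperbound) simp
    next
      case False
      with that before[of b j i] show ?thesis
        by simp
    qed
    have "F (x + a *\<^sub>R d) \<le> F x - (norm d)\<^sup>2 * a + M * (norm d)\<^sup>2 / 2 * a\<^sup>2"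
      using barrier_obj_le_model[of "x + a *\<^sub>R d" x] model[OF a(1) upto] by (simp add: part_line)
    also have "\<dots> = F x - (norm d)\<^sup>2 * a * (1 - M * a / 2)"
      by (simp add: power2_eq_square algebra_simps)
    also have "\<dots> \<le> F x"
    proof -
      have "M * a \<le> 1"
        using a M_pos by (simp add: pos_le_divide_eq mult.commute)
      then show ?thesis
        using a by simp
    qed
    finally have "F (x + a *\<^sub>R d) \<le> F x\<^sub>0"
      using x by simp
    moreover have "x + a *\<^sub>R d \<in> feas_BP D"
      using upto[OF a(1) order_refl] by (rule feasible)
    ultimately have "g i j a < - 1 / ?\<tau>"
      using j by (intro in_sublevel)
    with gij show False
      by simp
  qed
  have below: "g i j a \<le> - 1 / ?\<tau>" if "0 \<le> a" "a \<le> 1 / M" "j \<in> {1..nineq D i}" for i j a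
  proof (rule ccontr)
    assume "\<not> g i j a \<le> - 1 / ?\<tau>"
    then have "a \<in> hit"
      unfolding hit_def using that by (auto simp: not_le intro!: exI[of _ i] bexI[of _ j])
    then show False
      using \<open>hit = {}\<close> by simp
  qed
  have step: "0 \<le> 1 / M"
    using M_pos by simp
  show "x + (1 / M) *\<^sub>R d \<in> feas_BP D"
    using below[OF step order_refl] by (rule feasible)
  have "(norm d)\<^sup>2 * (1 / M) - M * (norm d)\<^sup>2 / 2 * (1 / M)\<^sup>2 = (norm d)\<^sup>2 / (2 * M)"
    using M_pos by (simp add: field_simps power2_eq_square)
  then show "(\<Sum>i\<in>UNIV. block_model D L \<rho> i (part D i x) (part D i x + (1 / M) *\<^sub>R part D i d))
      \<le> F x - (norm d)\<^sup>2 / (2 * M)"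
    using model[OF step below] by linarith
qed

section \<open>Decrease in one iteration\<close>

lemma local_obj_block_model:
  "local_obj D L \<rho> i x p = (\<Sum>j\<in>cnbrs D i. block_model D L \<rho> j (part D j x) (part D j x + p j))"
  by (simp add: local_obj_def block_model_def)

text \<open>
  The optimal local step is at least as good as the step from the negative projected gradient with
  length \<open>1 / M\<close>, which is feasible for the subproblem.
\<close>

lemma local_decrease:
  assumes x: "x \<in> feas_BP D" "F x \<le> F x\<^sub>0"
    and p: "is_arg_min (local_obj D L \<rho> j x) (local_feasible D j x) p"
  shows "(\<Sum>i\<in>cnbrs D j. block_model D L \<rho> i (part D i x) (part D i x + p i)
        - block_model D L \<rho> i (part D i x) (part D i x))
    \<le> - (norm (orth_proj_matrix (local_null D j) *v grad F x))\<^sup>2 / (2 * M)"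
proof -
  let ?m = "\<lambda>i u. block_model D L \<rho> i (part D i x) (part D i x + u)"
  define d where "d = - (orth_proj_matrix (local_null D j) *v grad F x)"
  define u where "u = (1 / M) *\<^sub>R d"
  have d_null: "d \<in> local_null D j"
    unfolding d_def by (intro subspace_neg subspace_local_null orth_proj_matrix_in)
  then have u_null: "u \<in> local_null D j"
    unfolding u_def by (intro subspace_scale subspace_local_null)
  have "grad F x \<bullet> d = - (norm d)\<^sup>2"
    using inner_orth_proj_matrix_self[OF subspace_local_null, of "grad F x" D j] by (simp add: d_def)
  note decrease = model_decrease[OF x coef_mult_local_null[OF d_null] this, folded u_def]
  have part_u: "part D i u = (1 / M) *\<^sub>R part D i d" for i
    by (simp add: u_def part_scaleR)
  have "local_feasible D j x (\<lambda>i. part D i u)"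
    using u_null decrease(1) by (auto simp: local_feasible_def local_null_def feas_BP_def part_add)
  then have "local_obj D L \<rho> j x p \<le> local_obj D L \<rho> j x (\<lambda>i. part D i u)"
    using p by (simp add: is_arg_min_linorder)
  then have "(\<Sum>i\<in>cnbrs D j. ?m i (p i) - ?m i 0) \<le> (\<Sum>i\<in>cnbrs D j. ?m i (part D i u) - ?m i 0)"
    by (simp add: local_obj_block_model sum_subtractf)
  also have "\<dots> = (\<Sum>i\<in>UNIV. ?m i (part D i u) - ?m i 0)"
    using u_null by (intro sum.mono_neutral_left) (auto simp: local_null_def)
  also have "\<dots> = (\<Sum>i\<in>UNIV. ?m i (part D i u)) - F x"
    by (simp add: sum_subtractf block_model_self barrier_obj_blockwise)
  also have "\<dots> \<le> - (norm d)\<^sup>2 / (2 * M)"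
    using decrease(2) by (simp add: part_u)
  finally show ?thesis
    by (simp add: d_def)
qed

lemma convex_on_block_model:
  assumes y: "y \<in> blk D i"
  shows "convex_on (Xint D i) (block_model D L \<rho> i y)"
proof -
  have quad: "convex_on (Xint D i) (\<lambda>u. (norm (u - y))\<^sup>2)"
  proof (rule convex_onI)
    fix t :: real and u v assume t: "0 < t" "t < 1"
    have "(1 - t) * (norm (u - y))\<^sup>2 + t * (norm (v - y))\<^sup>2
        - (norm ((1 - t) *\<^sub>R u + t *\<^sub>R v - y))\<^sup>2 = t * (1 - t) * (norm (u - v))\<^sup>2"
      unfolding power2_norm_eq_inner
      by (simp add: inner_diff_left inner_diff_right inner_add_left inner_add_right inner_commute
          algebra_simps)
    moreover have "0 \<le> t * (1 - t) * (norm (u - v))\<^sup>2"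
      using t by simp
    ultimately show "(norm ((1 - t) *\<^sub>R u + t *\<^sub>R v - y))\<^sup>2
        \<le> (1 - t) * (norm (u - y))\<^sup>2 + t * (norm (v - y))\<^sup>2"
      by linarith
  qed (rule convex_Xint)
  have lin: "convex_on (Xint D i) (\<lambda>u. obj D i y + grad_on (blk D i) (obj D i) y \<bullet> (u - y))"
    by (rule convex_onI[OF _ convex_Xint]) (simp add: inner_diff_right inner_add_right algebra_simps)
  show ?thesis
    unfolding block_model_def[abs_def] quad_model_def
    using \<rho>_pos L_pos[of i]
    by (intro convex_on_add[OF convex_on_add[OF lin convex_on_cmul[OF _ quad]]
          convex_on_cmul[OF _ convex_on_barrier]]) auto
qed

lemma local_feasible_sum:
  assumes "local_feasible D j x p"
  shows "coef D *v (\<Sum>i\<in>cnbrs D j. p i) = 0"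
  using assms by (simp add: local_feasible_def linear_sum[OF matrix_vector_mul_linear])

text \<open>
  In every block the new point is a damped displacement of the old one, so the convex model bounds
  its value by the weighted local decreases. Summing over the blocks and exchanging the sums
  collects, for every node, the decrease of its own subproblem.
\<close>

lemma iteration_decrease:
  assumes x: "x \<in> feas_BP D" "F x \<le> F x\<^sub>0"
    and p: "\<And>j. is_arg_min (local_obj D L \<rho> j x) (local_feasible D j x) (p j)"
    and x': "\<And>i. part D i x' = part D i x + (\<Sum>j\<in>cnbrs D i. step_weight D j *\<^sub>R p j i)"
  shows "x' \<in> feas_BP D"
    and "F x' \<le> F x - (\<Sum>j\<in>UNIV. step_weight D j *
      (norm (orth_proj_matrix (local_null D j) *v grad F x))\<^sup>2) / (2 * M)"
proof -
  let ?m = "\<lambda>i. block_model D L \<rho> i (part D i x)"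
  let ?P = "\<lambda>j. orth_proj_matrix (local_null D j) *v grad F x"
  have feas: "local_feasible D j x (p j)" for j
    using p[of j] by (simp add: is_arg_min_def)
  have int: "part D i x \<in> Xint D i" for i
    using x by (simp add: feas_BP_def)
  have p_int: "part D i x + p j i \<in> Xint D i" and p_blk: "p j i \<in> blk D i" if "j \<in> cnbrs D i" for i j
    using feas[of j] that by (auto simp: local_feasible_def cnbrs_sym[of j])
  have damped: "part D i x' \<in> Xint D i"
    "?m i (part D i x') \<le> ?m i (part D i x)
      + (\<Sum>j\<in>cnbrs D i. step_weight D j * (?m i (part D i x + p j i) - ?m i (part D i x)))" for i
    unfolding x'
    using convex_on_block_model[OF part_in_blk] int sum_step_weight_le_1 p_int step_weight_pos
    by (intro convex_on_damped_displacement[where C = "Xint D i" and h = "?m i"];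
        force intro: less_imp_le)+
  have "x' = x + (\<Sum>j\<in>UNIV. step_weight D j *\<^sub>R (\<Sum>i\<in>cnbrs D j. p j i))"
  proof (rule part_eqI)
    fix i
    have "part D i (\<Sum>l\<in>cnbrs D j. p j l) = (if j \<in> cnbrs D i then p j i else 0)" for j
      using part_sum_blocks[of "cnbrs D j" "p j" D i] p_blk by (auto simp: cnbrs_sym[of _ D j])
    then have "part D i (\<Sum>j\<in>UNIV. step_weight D j *\<^sub>R (\<Sum>i\<in>cnbrs D j. p j i))
        = (\<Sum>j\<in>UNIV. if j \<in> cnbrs D i then step_weight D j *\<^sub>R p j i else 0)"
      unfolding part_sum part_scaleR by (intro sum.cong) simp_all
    also have "\<dots> = (\<Sum>j\<in>cnbrs D i. step_weight D j *\<^sub>R p j i)"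
      by (simp add: sum.If_cases)
    finally show "part D i x' = part D i (x + (\<Sum>j\<in>UNIV. step_weight D j *\<^sub>R (\<Sum>i\<in>cnbrs D j. p j i)))"
      by (simp add: x' part_add)
  qed
  then have "coef D *v x' = coef D *v x"
    using local_feasible_sum[OF feas]
    by (simp add: matrix_vector_right_distrib linear_sum[OF matrix_vector_mul_linear]
        matrix_vector_mult_scaleR)
  with damped x show "x' \<in> feas_BP D"
    by (simp add: feas_BP_def)
  have nb: "{i \<in> UNIV. j \<in> cnbrs D i} = cnbrs D j" for j
    by (auto simp: cnbrs_sym[of j])
  have "F x' \<le> (\<Sum>i\<in>UNIV. ?m i (part D i x'))"
    by (rule barrier_obj_le_model)
  also have "\<dots> \<le> (\<Sum>i\<in>UNIV. ?m i (part D i x)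
      + (\<Sum>j\<in>cnbrs D i. step_weight D j * (?m i (part D i x + p j i) - ?m i (part D i x))))"
    by (intro sum_mono damped)
  also have "\<dots> = F x + (\<Sum>i\<in>UNIV. \<Sum>j\<in>{j \<in> UNIV. j \<in> cnbrs D i}.
      step_weight D j * (?m i (part D i x + p j i) - ?m i (part D i x)))"
    by (simp add: sum.distrib block_model_self barrier_obj_blockwise)
  also have "(\<Sum>i\<in>UNIV. \<Sum>j\<in>{j \<in> UNIV. j \<in> cnbrs D i}.
        step_weight D j * (?m i (part D i x + p j i) - ?m i (part D i x)))
      = (\<Sum>j\<in>UNIV. \<Sum>i\<in>{i \<in> UNIV. j \<in> cnbrs D i}.
        step_weight D j * (?m i (part D i x + p j i) - ?m i (part D i x)))"
    by (rule sum.swap_restrict) auto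
  also have "\<dots> = (\<Sum>j\<in>UNIV. step_weight D j *
      (\<Sum>i\<in>cnbrs D j. ?m i (part D i x + p j i) - ?m i (part D i x)))"
    unfolding nb by (simp add: sum_distrib_left)
  also have "\<dots> \<le> (\<Sum>j\<in>UNIV. step_weight D j * (- (norm (?P j))\<^sup>2 / (2 * M)))"
    using local_decrease[OF x p] less_imp_le[OF step_weight_pos] by (intro sum_mono mult_left_mono) auto
  also have "\<dots> = - (\<Sum>j\<in>UNIV. step_weight D j * (norm (?P j))\<^sup>2) / (2 * M)"
    by (simp add: sum_divide_distrib sum_negf)
  finally show "F x' \<le> F x - (\<Sum>j\<in>UNIV. step_weight D j * (norm (?P j))\<^sup>2) / (2 * M)"
    by simp
qed

section \<open>Lower bounds from convexity\<close>

lemma barrier_obj_lower_bound: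
  assumes x: "x \<in> feas_BP D" and y: "y \<in> feas_BP D"
    and obj: "\<And>i u v. u \<in> blk D i \<Longrightarrow> v \<in> blk D i \<Longrightarrow>
      obj D i u + grad_on (blk D i) (obj D i) u \<bullet> (v - u) + \<sigma> / 2 * (norm (v - u))\<^sup>2 \<le> obj D i v"
  shows "F x + grad F x \<bullet> (y - x) + \<sigma> / 2 * (norm (y - x))\<^sup>2 \<le> F y"
proof -
  have int: "part D i x \<in> Xint D i" "part D i y \<in> Xint D i" for i
    using x y by (auto simp: feas_BP_def)
  have part_diff: "part D i (y - x) = part D i y - part D i x" for i
    by (rule linear_diff[OF linear_part])
  have "F x + grad F x \<bullet> (y - x) + \<sigma> / 2 * (norm (y - x))\<^sup>2
      = (\<Sum>i\<in>UNIV. obj D i (part D i x) + \<rho> * barrier D i (part D i x)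
        + part D i (y - x) \<bullet> block_grad D \<rho> i (part D i x) + \<sigma> / 2 * (norm (part D i (y - x)))\<^sup>2)"
    by (simp add: sum.distrib barrier_obj_blockwise inner_grad_barrier_obj[OF int(1)]
        sum_distrib_left[symmetric] sum_norm_part del: times_divide_eq_left)
  also have "\<dots> \<le> (\<Sum>i\<in>UNIV. obj D i (part D i y) + \<rho> * barrier D i (part D i y))"
  proof (rule sum_mono)
    fix i
    let ?d = "part D i (y - x)"
    have "(barrier D i has_derivative (\<lambda>h. h \<bullet> barrier_grad D i (part D i x)))
        (at (part D i x) within Xint D i)"
      by (rule has_derivative_subset[OF barrier_has_derivative[OF int(1)]]) (auto simp: Xint_def)
    then have "barrier D i (part D i x) + ?d \<bullet> barrier_grad D i (part D i x) \<le> barrier D i (part D i y)"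
      unfolding part_diff by (intro convex_on_gradient_inequality[OF convex_on_barrier int])
    then have "\<rho> * (barrier D i (part D i x) + ?d \<bullet> barrier_grad D i (part D i x))
        \<le> \<rho> * barrier D i (part D i y)"
      using \<rho>_pos by simp
    moreover have "obj D i (part D i x) + ?d \<bullet> grad_on (blk D i) (obj D i) (part D i x)
        + \<sigma> / 2 * (norm ?d)\<^sup>2 \<le> obj D i (part D i y)"
      using obj[of "part D i x" i "part D i y"] by (simp add: part_diff inner_commute)
    ultimately show "obj D i (part D i x) + \<rho> * barrier D i (part D i x)
        + ?d \<bullet> block_grad D \<rho> i (part D i x) + \<sigma> / 2 * (norm ?d)\<^sup>2
        \<le> obj D i (part D i y) + \<rho> * barrier D i (part D i y)"
      by (simp add: block_grad_def inner_add_right distrib_left)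
  qed
  finally show ?thesis
    by (simp add: barrier_obj_blockwise)
qed

lemma convex_obj_lower_bound:
  assumes "convex_on (blk D i) (obj D i)" "u \<in> blk D i" "v \<in> blk D i"
  shows "obj D i u + grad_on (blk D i) (obj D i) u \<bullet> (v - u) \<le> obj D i v"
  using convex_on_gradient_inequality[OF assms obj_has_derivative[OF assms(2)]]
  by (simp add: inner_commute)

lemma strongly_convex_obj_lower_bound:
  assumes h: "strongly_convex_on (blk D i) \<sigma> (obj D i)" and uv: "u \<in> blk D i" "v \<in> blk D i"
  shows "obj D i u + grad_on (blk D i) (obj D i) u \<bullet> (v - u) + \<sigma> / 2 * (norm (v - u))\<^sup>2 \<le> obj D i v"
proof -
  have "grad_on (blk D i) (obj D i) u \<in> blk D i"
    using obj_smooth[of i] uv by (intro grad_on_derivative subspace_blk) (auto simp: smooth_fun_on_def)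
  then have "grad_on (blk D i) (obj D i) u \<in> subdiff_on (blk D i) (obj D i) u"
    using h uv convex_obj_lower_bound[of i u] by (auto simp: subdiff_on_def strongly_convex_on_def)
  then show ?thesis
    using h uv unfolding strongly_convex_on_def by (force simp: norm_minus_commute)
qed

end

section \<open>Convergence of the iteration\<close>

locale dfm = barrier_method D L \<beta> \<beta>\<^sub>1 \<rho> "x 0"
  for D :: "('N::finite, 'm::finite, 'v::finite) problem"
    and L :: "'v \<Rightarrow> real" and \<beta> \<beta>\<^sub>1 \<rho> :: real and x :: "nat \<Rightarrow> real^'N" +
  assumes reachable: "reachability D"
    and dfm: "dfm_sequence D L \<rho> x"
begin

abbreviation W where "W \<equiv> weight_matrix D"
abbreviation lam where "lam \<equiv> least_nonzero_eigenvalue W"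
abbreviation Fstar where "Fstar \<equiv> real_of_ereal (opt_BP D \<rho>)"
abbreviation null where "null \<equiv> {u. coef D *v u = 0}"

sublocale weighted_projections "local_null D" "step_weight D" null W
  using reachable by (rule weighted_projections_weight_matrix)

lemma wnorm_sq: "(wnorm W g)\<^sup>2 = g \<bullet> (W *v g)"
  by (simp add: wnorm_def inner_W_nonneg)

lemma
  shows iterate_feasible: "x k \<in> feas_BP D"
    and iterate_le: "F (x k) \<le> F (x 0)"
    and iterate_decrease: "F (x (Suc k)) \<le> F (x k) - (wnorm W (grad F (x k)))\<^sup>2 / (2 * M)"
proof -
  obtain p where p: "\<And>k j. is_arg_min (local_obj D L \<rho> j (x k)) (local_feasible D j (x k)) (p k j)"
    "\<And>k i. part D i (x (Suc k)) = part D i (x k) + (\<Sum>j\<in>cnbrs D i. step_weight D j *\<^sub>R p k j i)"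
    using dfm by (auto simp: dfm_sequence_def)
  have step: "x (Suc k) \<in> feas_BP D"
    "F (x (Suc k)) \<le> F (x k) - (wnorm W (grad F (x k)))\<^sup>2 / (2 * M)"
    if "x k \<in> feas_BP D" "F (x k) \<le> F (x 0)" for k
    using iteration_decrease[OF that p(1) p(2)] by (simp_all add: wnorm_sq inner_W_self)
  have inv: "x k \<in> feas_BP D \<and> F (x k) \<le> F (x 0)" for k
  proof (induction k)
    case (Suc k)
    have "0 \<le> (wnorm W (grad F (x k)))\<^sup>2 / (2 * M)"
      using M_pos by simp
    then show ?case
      using step[of k] Suc by auto
  qed (simp add: start)
  show "x k \<in> feas_BP D" "F (x k) \<le> F (x 0)"
    "F (x (Suc k)) \<le> F (x k) - (wnorm W (grad F (x k)))\<^sup>2 / (2 * M)"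
    using inv[of k] step(2)[of k] by auto
qed

lemma
  shows summable_gradients: "summable (\<lambda>k. (wnorm W (grad F (x k)))\<^sup>2)"
    and suminf_gradients_le: "(\<Sum>k. (wnorm W (grad F (x k)))\<^sup>2) \<le> 2 * M * (F (x 0) - fstar)"
proof -
  have "(\<Sum>k<n. (wnorm W (grad F (x k)))\<^sup>2) \<le> 2 * M * (F (x 0) - F (x n))" for n
  proof (induction n)
    case (Suc n)
    have "(wnorm W (grad F (x n)))\<^sup>2 \<le> 2 * M * (F (x n) - F (x (Suc n)))"
      using iterate_decrease[of n] M_pos by (simp add: field_simps)
    with Suc show ?case
      by (simp add: algebra_simps)
  qed simp
  moreover have "2 * M * (F (x 0) - F (x n)) \<le> 2 * M * (F (x 0) - fstar)" for n
    using M_pos fstar_le_F[OF iterate_feasible[of n]] by simp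
  ultimately have bound: "(\<Sum>k<n. (wnorm W (grad F (x k)))\<^sup>2) \<le> 2 * M * (F (x 0) - fstar)" for n
    using order_trans by blast
  show sum: "summable (\<lambda>k. (wnorm W (grad F (x k)))\<^sup>2)"
    by (rule summableI_nonneg_bounded[OF _ bound]) simp
  show "(\<Sum>k. (wnorm W (grad F (x k)))\<^sup>2) \<le> 2 * M * (F (x 0) - fstar)"
    using sum bound by (rule suminf_le_const)
qed

lemma Fstar_le: "y \<in> feas_BP D \<Longrightarrow> Fstar \<le> F y"
  unfolding opt_BP_def by (intro opt_value_le opt_value_bounded_below(1)[where c = fstar] fstar_le_F)

lemma Fstar_ge: "(\<And>y. y \<in> feas_BP D \<Longrightarrow> c \<le> F y) \<Longrightarrow> c \<le> Fstar"
  unfolding opt_BP_def using start by (intro opt_value_bounded_below) auto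

lemma feasible_diff: "y \<in> feas_BP D \<Longrightarrow> z \<in> feas_BP D \<Longrightarrow> y - z \<in> null"
  by (simp add: feas_BP_def matrix_vector_mult_diff_distrib)

text \<open>
  If \<open>A\<close> is injective, then \<open>W = 0\<close> has no nonzero eigenvalue and \<open>lam\<close> has an arbitrary value. The
  rates hold all the same, as there is only one feasible point.
\<close>

lemma trivial_null:
  assumes "null = {0}"
  shows feas_BP_trivial: "feas_BP D = {x 0}"
    and gap_trivial: "F (x k) - Fstar = 0"
proof -
  have eq: "y = x 0" if "y \<in> feas_BP D" for y
    using feasible_diff[OF that start] assms by auto
  then show "feas_BP D = {x 0}"
    using start by blast
  have "F (x 0) \<le> Fstar"
    by (rule Fstar_ge) (auto dest: eq)
  then show "F (x k) - Fstar = 0"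
    using Fstar_le[OF start] eq[OF iterate_feasible[of k]] by simp
qed

text \<open>
  The infimum may be taken over the sublevel set alone, in which every point is within its diameter
  of the current iterate.
\<close>

lemma convex_gap:
  assumes convex: "\<And>i. convex_on (blk D i) (obj D i)"
    and bounded: "bounded {y \<in> feas_BP D. F y \<le> F (x 0)}" and nontrivial: "null \<noteq> {0}"
  shows "lam * (F (x k) - Fstar)\<^sup>2
    \<le> (wnorm W (grad F (x k)))\<^sup>2 * (diameter {y \<in> feas_BP D. F y \<le> F (x 0)})\<^sup>2"
proof -
  let ?C = "{y \<in> feas_BP D. F y \<le> F (x 0)}"
  let ?Q = "(wnorm W (grad F (x k)))\<^sup>2" and ?R = "diameter ?C"
  have lam: "0 < lam"
    using spectral_gap_inner(1)[of 0] nontrivial by simp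
  have "F (x k) - sqrt (?Q * ?R\<^sup>2 / lam) \<le> Fstar"
  proof (rule Fstar_ge)
    fix y assume y: "y \<in> feas_BP D"
    have nonneg: "0 \<le> sqrt (?Q * ?R\<^sup>2 / lam)"
      using lam by simp
    show "F (x k) - sqrt (?Q * ?R\<^sup>2 / lam) \<le> F y"
    proof (cases "F y \<le> F (x 0)")
      case True
      have z: "x k - y \<in> null"
        using iterate_feasible y by (rule feasible_diff)
      have "norm (x k - y) \<le> ?R"
        using diameter_bounded_bound[OF bounded, of "x k" y] True y iterate_feasible iterate_le
        by (simp add: dist_norm)
      then have "(norm (x k - y))\<^sup>2 \<le> ?R\<^sup>2"
        by (rule power_mono) simp
      then have "?Q * (norm (x k - y))\<^sup>2 \<le> ?Q * ?R\<^sup>2"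
        by (rule mult_left_mono) simp
      moreover have "lam * (grad F (x k) \<bullet> (x k - y))\<^sup>2 \<le> ?Q * (norm (x k - y))\<^sup>2"
        unfolding wnorm_sq by (rule spectral_gap_inner(2)[OF z nontrivial])
      ultimately have "(grad F (x k) \<bullet> (x k - y))\<^sup>2 \<le> ?Q * ?R\<^sup>2 / lam"
        using lam by (simp add: pos_le_divide_eq mult.commute)
      then have "grad F (x k) \<bullet> (x k - y) \<le> sqrt (?Q * ?R\<^sup>2 / lam)"
        by (rule real_le_rsqrt)
      moreover have "F (x k) + grad F (x k) \<bullet> (y - x k) + 0 / 2 * (norm (y - x k))\<^sup>2 \<le> F y"
        by (rule barrier_obj_lower_bound[OF iterate_feasible y])
          (simp add: convex_obj_lower_bound[OF convex])
      ultimately show ?thesis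
        by (simp add: inner_diff_right)
    next
      case False
      then show ?thesis
        using iterate_le[of k] nonneg by linarith
    qed
  qed
  then have "F (x k) - Fstar \<le> sqrt (?Q * ?R\<^sup>2 / lam)"
    by simp
  moreover have "0 \<le> F (x k) - Fstar"
    using Fstar_le[OF iterate_feasible] by simp
  ultimately have "(F (x k) - Fstar)\<^sup>2 \<le> (sqrt (?Q * ?R\<^sup>2 / lam))\<^sup>2"
    by (rule power_mono)
  also have "\<dots> = ?Q * ?R\<^sup>2 / lam"
    using lam by simp
  finally show ?thesis
    using lam by (simp add: pos_le_divide_eq mult.commute)
qed

lemma convex_rate:
  assumes convex: "\<And>i. convex_on (blk D i) (obj D i)"
    and bounded: "bounded {y \<in> feas_BP D. F y \<le> F (x 0)}" and k: "1 \<le> k"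
  shows "F (x k) - Fstar
    \<le> 2 * M * (diameter {y \<in> feas_BP D. F y \<le> F (x 0)})\<^sup>2 / (real k * lam)"
proof (cases "null = {0}")
  case True
  then have "{y \<in> feas_BP D. F y \<le> F (x 0)} = {x 0}"
    using feas_BP_trivial by auto
  then show ?thesis
    using gap_trivial[OF True, of k] by simp
next
  case False
  let ?Q = "\<lambda>k. (wnorm W (grad F (x k)))\<^sup>2" and ?R = "diameter {y \<in> feas_BP D. F y \<le> F (x 0)}"
  have lam: "0 < lam"
    using spectral_gap_inner(1)[of 0] False by simp
  have gap: "lam * (F (x k) - Fstar)\<^sup>2 \<le> ?Q k * ?R\<^sup>2" for k
    using convex bounded False by (rule convex_gap)
  show ?thesis
  proof (cases "?R = 0")
    case True
    then have "lam * (F (x k) - Fstar)\<^sup>2 \<le> 0"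
      using gap[of k] by simp
    then have "F (x k) - Fstar = 0"
      using lam by (simp add: mult_le_0_iff)
    then show ?thesis
      using True by simp
  next
    case False
    define a where "a = lam / (2 * M * ?R\<^sup>2)"
    have R: "0 < ?R\<^sup>2"
      using False by simp
    then have a: "0 < a"
      using lam M_pos by (simp add: a_def)
    have "real k * (a * (F (x k) - Fstar)) \<le> 1"
    proof (rule quadratic_decrease_rate)
      fix k
      have "a * (F (x k) - Fstar)\<^sup>2 = lam * (F (x k) - Fstar)\<^sup>2 / (2 * M * ?R\<^sup>2)"
        by (simp add: a_def)
      also have "\<dots> \<le> ?Q k * ?R\<^sup>2 / (2 * M * ?R\<^sup>2)"
        using gap M_pos by (intro divide_right_mono) auto
      also have "\<dots> = ?Q k / (2 * M)"
        using False by simp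
      finally show "F (x (Suc k)) - Fstar \<le> F (x k) - Fstar - a * (F (x k) - Fstar)\<^sup>2"
        using iterate_decrease[of k] by linarith
    qed (use a Fstar_le[OF iterate_feasible] in auto)
    then have "F (x k) - Fstar \<le> 1 / (real k * a)"
      using a k by (simp add: pos_le_divide_eq mult_ac)
    also have "1 / (real k * a) = 2 * M * ?R\<^sup>2 / (real k * lam)"
      by (simp add: a_def)
    finally show ?thesis .
  qed
qed

text \<open>
  The lower bound from strong convexity is minimised over displacements in the null space; the
  minimum is governed by the dual norm of the gradient there, which the spectral gap controls.
\<close>

lemma strongly_convex_gap:
  assumes strong: "\<And>i. strongly_convex_on (blk D i) \<sigma> (obj D i)" and \<sigma>: "0 < \<sigma>"
    and nontrivial: "null \<noteq> {0}"
  shows "F (x k) - Fstar \<le> (wnorm W (grad F (x k)))\<^sup>2 / (2 * \<sigma> * lam)"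
proof -
  define q where "q = (wnorm W (grad F (x k)))\<^sup>2 / lam"
  have lam: "0 < lam"
    using spectral_gap_inner(1)[of 0] nontrivial by simp
  have "F (x k) - q / (2 * \<sigma>) \<le> Fstar"
  proof (rule Fstar_ge)
    fix y assume y: "y \<in> feas_BP D"
    define z where "z = y - x k"
    have z: "z \<in> null"
      unfolding z_def using y iterate_feasible by (rule feasible_diff)
    have "lam * (grad F (x k) \<bullet> z)\<^sup>2 \<le> (wnorm W (grad F (x k)))\<^sup>2 * (norm z)\<^sup>2"
      unfolding wnorm_sq by (rule spectral_gap_inner(2)[OF z nontrivial])
    then have "(grad F (x k) \<bullet> z)\<^sup>2 \<le> q * (norm z)\<^sup>2"
      using lam by (simp add: q_def field_simps)
    also have "\<dots> \<le> (q / (2 * \<sigma>) + \<sigma> / 2 * (norm z)\<^sup>2)\<^sup>2"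
    proof -
      have "(q / (2 * \<sigma>) + \<sigma> / 2 * (norm z)\<^sup>2)\<^sup>2
          = (q / (2 * \<sigma>) - \<sigma> / 2 * (norm z)\<^sup>2)\<^sup>2 + q * (norm z)\<^sup>2"
        using \<sigma> by (simp add: power2_sum power2_diff)
      then show ?thesis
        by simp
    qed
    finally have "\<bar>grad F (x k) \<bullet> z\<bar> \<le> \<bar>q / (2 * \<sigma>) + \<sigma> / 2 * (norm z)\<^sup>2\<bar>"
      by (simp add: abs_le_square_iff)
    also have "\<dots> = q / (2 * \<sigma>) + \<sigma> / 2 * (norm z)\<^sup>2"
      using lam \<sigma> by (intro abs_of_nonneg) (simp add: q_def)
    finally have "- (q / (2 * \<sigma>)) \<le> grad F (x k) \<bullet> z + \<sigma> / 2 * (norm z)\<^sup>2"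
      by linarith
    moreover have "F (x k) + grad F (x k) \<bullet> z + \<sigma> / 2 * (norm z)\<^sup>2 \<le> F y"
      unfolding z_def
      by (rule barrier_obj_lower_bound[OF iterate_feasible y strongly_convex_obj_lower_bound[OF strong]])
    ultimately show "F (x k) - q / (2 * \<sigma>) \<le> F y"
      by linarith
  qed
  then show ?thesis
    by (simp add: q_def mult_ac)
qed

lemma strongly_convex_rate:
  assumes strong: "\<And>i. strongly_convex_on (blk D i) \<sigma> (obj D i)" and \<sigma>: "0 < \<sigma>"
  shows "F (x k) - Fstar \<le> (1 - \<sigma> * lam / M) ^ k * (F (x 0) - Fstar)"
proof (cases "null = {0}")
  case True
  then show ?thesis
    using gap_trivial[OF True, of k] gap_trivial[OF True, of 0] by simp
next
  case False
  have lam: "0 < lam"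
    using spectral_gap_inner(1)[of 0] False by simp
  show ?thesis
  proof (rule linear_decrease_rate)
    fix k
    show "0 \<le> F (x k) - Fstar"
      using Fstar_le[OF iterate_feasible] by simp
    have "F (x k) - Fstar \<le> (wnorm W (grad F (x k)))\<^sup>2 / (2 * \<sigma> * lam)"
      using strong \<sigma> False by (rule strongly_convex_gap)
    then have "\<sigma> * lam / M * (F (x k) - Fstar)
        \<le> \<sigma> * lam / M * ((wnorm W (grad F (x k)))\<^sup>2 / (2 * \<sigma> * lam))"
      using lam \<sigma> M_pos by (intro mult_left_mono) auto
    also have "\<dots> = (wnorm W (grad F (x k)))\<^sup>2 / (2 * M)"
      using lam \<sigma> by simp
    finally show "F (x (Suc k)) - Fstar \<le> (1 - \<sigma> * lam / M) * (F (x k) - Fstar)"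
      using iterate_decrease[of k] by (simp add: left_diff_distrib)
  qed
qed

end

theorem theorem1:
  fixes D :: "('N::finite, 'm::finite, 'v::finite) problem"
    and L :: "'v \<Rightarrow> real" and \<beta> \<beta>\<^sub>1 \<rho> :: real and x :: "nat \<Rightarrow> real^'N"
  assumes "undirected_graph (edges D)"
    and "regular_problem D L \<beta> \<beta>\<^sub>1"
    and "reachability D"
    and "\<rho> > 0"
    and "x 0 \<in> feas_BP D"
    and "dfm_sequence D L \<rho> x"
  shows "let F = barrier_obj D \<rho>;
             fstar = real_of_ereal (opt_P D);
             Fstar = real_of_ereal (opt_BP D \<rho>);
             W = weight_matrix D;
             lam = least_nonzero_eigenvalue W;
             Lmax = max_smoothness L;
             LB = barrier_smoothness D \<rho> \<beta> \<beta>\<^sub>1 (x 0);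
             C = {y \<in> feas_BP D. F y \<le> F (x 0)}
         in (\<forall>k. x k \<in> feas_BP D \<and> x k \<in> feas_P D) \<and>
            summable (\<lambda>k. (wnorm W (grad F (x k)))\<^sup>2) \<and>
            (\<Sum>k. (wnorm W (grad F (x k)))\<^sup>2) \<le> 2 * (\<rho> * LB + Lmax) * (F (x 0) - fstar) \<and>
            ((\<forall>i. convex_on (blk D i) (obj D i)) \<and> compact C \<longrightarrow>
               (\<forall>k\<ge>1. F (x k) - Fstar
                  \<le> 2 * (Lmax + \<rho> * LB) * (diameter C)\<^sup>2 / (real k * lam))) \<and>
            (\<forall>\<sigma>>0. (\<forall>i. strongly_convex_on (blk D i) \<sigma> (obj D i)) \<longrightarrow>
               (\<forall>k. F (x k) - Fstar
                  \<le> (1 - \<sigma> * lam / (Lmax + \<rho> * LB)) ^ k * (F (x 0) - Fstar)))"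
proof -
  interpret dfm D L \<beta> \<beta>\<^sub>1 \<rho> x
    using assms by unfold_locales
  have "x k \<in> feas_BP D \<and> x k \<in> feas_P D" for k
    using iterate_feasible feas_BP_subset_feas_P by blast
  then show ?thesis
    unfolding Let_def add.commute[of "\<rho> * _" Lmax]
    using summable_gradients suminf_gradients_le convex_rate compact_imp_bounded strongly_convex_rate
    unfolding M_def by blast
qed

end
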